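(* Let $t\le T-1$. Suppose that the cost process $C$ is positively super $\delta$-homogeneous. Suppose that there exists an $\mathcal F_{t+1}$-normal integrand $\tilde\gamma_{t+1}^{\xi}$ on $\Omega\times\mathbb R^m\times\mathbb R^d$ such that $\gamma_{t+1}^{\xi}(V_t)=\tilde\gamma_{t+1}^{\xi}(S_{t+1},V_t)$ for all $V_t\in L^0(\mathbb R^d,\mathcal F_t)$. Assume that: (a) $\xi=g(S_T)$ where $g$ is continuous with values in $\mathbb R^d_+$, and $\xi$ is hedgeable; (b) for each $u\le T-1$, $\operatorname{supp}_{\mathcal F_u}S_{u+1}=\phi_u(S_u)$, where $\phi_u$ is a lower hemicontinuous set-valued function on $\mathbb R^m$ with compact values such that $\phi_u(S_u)\subseteq\bar B(0,R_u(S_u))$ for a continuous function $R_u$ on $\mathbb R^m$. Suppose that $C_t(s,z)$ is an $\mathcal F_t$-normal integrand and that $C_t$ is either super-additive or sub-additive in $z$. Then, if $\inf_{z\in S^{d-1}(0,1)}D_t^0(S_t,0,z)>0$ a.s., we have $\gamma_t^{\xi}(V_{t-1})=\tilde\gamma_t^{\xi}(S_t,V_{t-1})$ a.s. for all $V_{t-1}\in L^0(\mathbb R^d,\mathcal F_t)$, where $\tilde\gamma_t^{\xi}(s,v_{t-1})$ is an $\mathcal F_t$-normal integrand on $\Omega\times\mathbb R^m\times\mathbb R^d$.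
   Context: Setting. $(\Omega,(\mathcal F_t)_{t=0}^T,P)$ is a discrete-time stochastic basis with complete filtration ($\mathcal F_0$ contains the $P$-null sets); $\mathcal F_{-1}:=\mathcal F_0$. For a (random) set $A\subseteq\mathbb R^k$, $L^0(A,\mathcal F_t)$ is the set of (classes of) $\mathcal F_t$-measurable random variables $X$ with $X\in A$ a.s. For $z\in\mathbb R^d$ write $z=(z^1,z^{(2)})$ with $z^{(2)}=(z^2,\dots,z^d)$, and $e_1=(1,0,\dots,0)$. $\bar B(0,r)$ is the closed ball and $S^{d-1}(0,1):=\{z\in\mathbb R^d:z^1=0,\ |z|=1\}$. For a family of random variables, $\operatorname{ess\,sup}_{\mathcal F_t}$ (resp. $\operatorname{ess\,inf}_{\mathcal F_t}$) is the smallest (resp. largest) $\mathcal F_t$-measurable $[-\infty,\infty]$-valued random variable which a.s. dominates (resp. is a.s. dominated by) every member; for a single random variable $X$ it is that of $\{X\}$. An $\mathcal F$-normal integrand is an (extended real-valued) function $f(\omega,x)$ on $\Omega\times\mathbb R^k$ that is $\mathcal F\otimes\mathcal B(\mathbb R^k)$-measurable and lower semicontinuous in $x$; $f(Z)$ denotes $\omega\mapsto f(\omega,Z(\omega))$. $\operatorname{supp}_{\mathcal F_t}S_{t+1}$ (conditional support) is the smallest $\mathcal F_t$-measurable random closed set containing $S_{t+1}$ a.s. Market. $S_t$ is an $\mathcal F_t$-measurable $\mathbb R^m_+$-valued random variable ($m\ge d\ge 1$). For $t\le T$ the cost function $C_t:\mathbb R^m\times\mathbb R^d\to\mathbb R$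 is Borel and lower semicontinuous and satisfies: $C_t(s,0)=0$ for $s\in\mathbb R^m_+$; $C_t(s,x+\lambda e_1)=C_t(s,x)+\lambda$ for $\lambda\in\mathbb R$; $C_T(s,x_2)\ge C_T(s,x_1)$ whenever $x_2-x_1\in\mathbb R^d_+$; $|C_t(s,x)|\le h_t(s,x)$ for a deterministic continuous function $h_t$. One writes $C_t(x)=C_t(S_t,x)$. The solvency sets are $G_t=\{z\in\mathbb R^d: -C_t(-z)\ge 0\}$; they are closed, graph-measurable w.r.t. $\mathcal F_t$, satisfy $G_t+\mathbb R^d_+\subseteq G_t$, $-e_1\notin G_t$, and $C_t(z)=\min\{\alpha\in\mathbb R:\alpha e_1-z\in G_t\}$. A portfolio process is an adapted $\mathbb R^d$-valued process $V$ with $V_{-1}\in\mathbb R e_1$ and $V_t-V_{t-1}\in -G_t$ a.s. for $t=0,\dots,T$. The payoff $\xi$ is hedgeable if there is a portfolio process $V^\xi$ with $V_T^\xi=\xi$. Super $\delta$-homogeneity: $\delta$ is an increasing bijection of $[0,+\infty]$ with $\delta(0)=0$, $\delta(\infty)=\infty$, and $C$ is positively super $\delta$-homogeneous if, for every $t\le T$, $C_t(s,\lambda x)\ge\delta(\lambda)C_t(s,x)$ for all $\lambda\ge1$, $s\in\mathbb R^m_+$, $x\in\mathbb R^d$. Hedging costs. For $\xi\in L^0(\mathbb R^d,\mathcal F_T)$, $0\le t\le T$ and $V_{t-1}\in L^0(\mathbb R^d,\mathcal F_t)$, $$\gamma_t^{\xi}(V_{t-1}):=\operatorname*{ess\,inf}_{V^{(2)}\in\Pi_t^T(V_{t-1},\xi)}{}_{\mathcal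 F_t}\ \operatorname{ess\,sup}_{\mathcal F_t}\Big(\xi^1+\sum_{s=t}^T C_s\big(0,V_s^{(2)}-V_{s-1}^{(2)}\big)\Big),$$ where $\Pi_t^T(V_{t-1},\xi)$ is the set of families $(V_s^{(2)})_{s=t-1}^T$ whose entry at $t-1$ is the given $V_{t-1}^{(2)}$, with $V_s^{(2)}\in L^0(\mathbb R^{d-1},\mathcal F_s)$ for $s=t,\dots,T-1$ and $V_T^{(2)}=\xi^{(2)}$. For $t\le T-1$, $\theta_t^\xi(V_t):=\operatorname{ess\,sup}_{\mathcal F_t}\gamma_{t+1}^\xi(V_t)$ and $D_t^\xi(S_t,V_{t-1},V_t):=C_t(S_t,(0,V_t^{(2)}-V_{t-1}^{(2)}))+\theta_t^\xi(V_t)$. Superscript $0$ means payoff $\xi=0$. Pointwise version: when $D_t^0(S_t,0,z)$ is evaluated at deterministic $z$, $\theta_t^0$ is identified with an $\mathcal F_t$-normal integrand $\tilde\theta_t^0$ on $\Omega\times\mathbb R^d$ such that $\theta_t^0(V)=\tilde\theta_t^0(V)$ a.s. for all $V\in L^0(\mathbb R^d,\mathcal F_t)$, i.e. $D_t^0(S_t,0,z)=C_t(S_t,(0,z^{(2)}))+\tilde\theta_t^0(z)$. *)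

theory Defs
  imports "HOL-Probability.Probability"
begin

section \<open>Measurability notions\<close>

text \<open>
  Sub-\<open>\<sigma>\<close>-algebras of the probability space \<open>M\<close> are represented by objects \<open>G\<close> of
  type \<open>'a measure\<close>, of which only \<open>space G\<close> and \<open>sets G\<close> are used (\<open>subalgebra M G\<close>);
  ``almost surely'' always refers to \<open>M\<close>. Random variables are functions, not classes.
\<close>

definition L0 :: "'a measure \<Rightarrow> 'a measure \<Rightarrow> 'b::topological_space set \<Rightarrow> ('a \<Rightarrow> 'b) set" where
  "L0 M G A = {X \<in> borel_measurable G. AE \<omega> in M. X \<omega> \<in> A}"

definition is_ess_sup ::
    "'a measure \<Rightarrow> 'a measure \<Rightarrow> ('a \<Rightarrow> ereal) set \<Rightarrow> ('a \<Rightarrow> ereal) \<Rightarrow> bool" where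
  "is_ess_sup M G XS Y \<longleftrightarrow>
     Y \<in> borel_measurable G \<and>
     (\<forall>X\<in>XS. AE \<omega> in M. X \<omega> \<le> Y \<omega>) \<and>
     (\<forall>Z\<in>borel_measurable G. (\<forall>X\<in>XS. AE \<omega> in M. X \<omega> \<le> Z \<omega>) \<longrightarrow> (AE \<omega> in M. Y \<omega> \<le> Z \<omega>))"

definition is_ess_inf ::
    "'a measure \<Rightarrow> 'a measure \<Rightarrow> ('a \<Rightarrow> ereal) set \<Rightarrow> ('a \<Rightarrow> ereal) \<Rightarrow> bool" where
  "is_ess_inf M G XS Y \<longleftrightarrow>
     Y \<in> borel_measurable G \<and>
     (\<forall>X\<in>XS. AE \<omega> in M. Y \<omega> \<le> X \<omega>) \<and>
     (\<forall>Z\<in>borel_measurable G. (\<forall>X\<in>XS. AE \<omega> in M. Z \<omega> \<le> X \<omega>) \<longrightarrow> (AE \<omega> in M. Z \<omega> \<le> Y \<omega>))"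

text \<open>
  On a probability space the essential supremum and infimum of a family of random variables
  exist and are unique up to a null set, so the choice only selects a version. They differ
  from the library's \<open>esssup\<close>, which is a constant, in being \<open>G\<close>-measurable functions.
\<close>

definition ess_sup :: "'a measure \<Rightarrow> 'a measure \<Rightarrow> ('a \<Rightarrow> ereal) set \<Rightarrow> 'a \<Rightarrow> ereal" where
  "ess_sup M G XS = (SOME Y. is_ess_sup M G XS Y)"

definition ess_inf :: "'a measure \<Rightarrow> 'a measure \<Rightarrow> ('a \<Rightarrow> ereal) set \<Rightarrow> 'a \<Rightarrow> ereal" where
  "ess_inf M G XS = (SOME Y. is_ess_inf M G XS Y)"

definition lsc :: "('b::topological_space \<Rightarrow> 'c::linorder) \<Rightarrow> bool" where
  "lsc f \<longleftrightarrow> (\<forall>x. \<forall>a < f x. \<forall>\<^sub>F y in nhds x. a < f y)"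

definition normal_integrand :: "'a measure \<Rightarrow> ('a \<Rightarrow> 'b::topological_space \<Rightarrow> ereal) \<Rightarrow> bool" where
  "normal_integrand G f \<longleftrightarrow>
     (\<lambda>(\<omega>, x). f \<omega> x) \<in> borel_measurable (G \<Otimes>\<^sub>M borel) \<and> (\<forall>\<omega>\<in>space G. lsc (f \<omega>))"

definition lower_hemicontinuous :: "('b::topological_space \<Rightarrow> 'c::topological_space set) \<Rightarrow> bool" where
  "lower_hemicontinuous \<phi> \<longleftrightarrow> (\<forall>U. open U \<longrightarrow> open {s. \<phi> s \<inter> U \<noteq> {}})"

definition random_closed_set :: "'a measure \<Rightarrow> ('a \<Rightarrow> 'b::topological_space set) \<Rightarrow> bool" where
  "random_closed_set G \<Gamma> \<longleftrightarrow>
     (\<forall>\<omega>\<in>space G. closed (\<Gamma> \<omega>)) \<and>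
     (\<forall>U. open U \<longrightarrow> {\<omega>\<in>space G. \<Gamma> \<omega> \<inter> U \<noteq> {}} \<in> sets G)"

text \<open>
  \<open>\<Gamma>\<close> is (a version of) the conditional support of \<open>X\<close> given \<open>G\<close>; it is unique up to a null set.
\<close>

definition is_cond_support ::
    "'a measure \<Rightarrow> 'a measure \<Rightarrow> ('a \<Rightarrow> 'b::topological_space) \<Rightarrow> ('a \<Rightarrow> 'b set) \<Rightarrow> bool" where
  "is_cond_support M G X \<Gamma> \<longleftrightarrow>
     random_closed_set G \<Gamma> \<and> (AE \<omega> in M. X \<omega> \<in> \<Gamma> \<omega>) \<and>
     (\<forall>\<Gamma>'. random_closed_set G \<Gamma>' \<longrightarrow> (AE \<omega> in M. X \<omega> \<in> \<Gamma>' \<omega>) \<longrightarrow>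
        (AE \<omega> in M. \<Gamma> \<omega> \<subseteq> \<Gamma>' \<omega>))"


section \<open>The market\<close>

text \<open>
  \<open>\<real>\<^sup>d\<close> is \<open>real ^ 'd\<close> with a distinguished index \<open>k\<close> for the first (cash) coordinate, so
  \<open>e\<^sub>1\<close> is \<open>axis k 1\<close>. The vector \<open>z\<^sup>(\<^sup>2\<^sup>)\<close> of the remaining coordinates is represented by
  \<open>(0, z\<^sup>(\<^sup>2\<^sup>))\<close>, that is, \<open>\<real>\<^sup>d\<^sup>-\<^sup>1\<close> is identified with the hyperplane \<open>noncash_space k\<close>
  (which is \<open>{0}\<close> if \<open>d = 1\<close>). The order on \<open>real ^ 'n\<close> is the componentwise one.
\<close>

definition noncash :: "'d \<Rightarrow> real ^ 'd \<Rightarrow> real ^ 'd" where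
  "noncash k z = (\<chi> i. if i = k then 0 else z $ i)"

definition noncash_space :: "'d::finite \<Rightarrow> (real ^ 'd) set" where
  "noncash_space k = {z. z $ k = 0}"

definition noncash_sphere :: "'d::finite \<Rightarrow> (real ^ 'd) set" where
  "noncash_sphere k = {z. z $ k = 0 \<and> norm z = 1}"

definition solvency_set ::
    "(nat \<Rightarrow> 'a \<Rightarrow> real ^ 'm) \<Rightarrow> (nat \<Rightarrow> real ^ 'm \<Rightarrow> real ^ 'd \<Rightarrow> real) \<Rightarrow> nat \<Rightarrow> 'a \<Rightarrow> (real ^ 'd) set" where
  "solvency_set S C t \<omega> = {z. - C t (S t \<omega>) (- z) \<ge> 0}"

locale cost_market = prob_space M + complete_measure M
  for M :: "'a measure" +
  fixes F :: "nat \<Rightarrow> 'a measure"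
    and T :: nat
    and S :: "nat \<Rightarrow> 'a \<Rightarrow> real ^ 'm"
    and C :: "nat \<Rightarrow> real ^ 'm \<Rightarrow> real ^ 'd \<Rightarrow> real"
    and k :: 'd
  assumes dims: "CARD('d) \<le> CARD('m)"
    and subalg: "t \<le> T \<Longrightarrow> subalgebra M (F t)"
    and filtration_mono: "u \<le> t \<Longrightarrow> t \<le> T \<Longrightarrow> sets (F u) \<subseteq> sets (F t)"
    and complete_filtration: "null_sets M \<subseteq> sets (F 0)"
    and S_measurable: "t \<le> T \<Longrightarrow> S t \<in> borel_measurable (F t)"
    and S_nonneg: "t \<le> T \<Longrightarrow> \<omega> \<in> space M \<Longrightarrow> 0 \<le> S t \<omega>"
    and C_borel: "t \<le> T \<Longrightarrow> (\<lambda>(s, x). C t s x) \<in> borel_measurable borel"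
    and C_lsc: "t \<le> T \<Longrightarrow> lsc (\<lambda>(s, x). C t s x)"
    and C_zero: "t \<le> T \<Longrightarrow> 0 \<le> s \<Longrightarrow> C t s 0 = 0"
    and C_cash: "t \<le> T \<Longrightarrow> C t s (x + l *\<^sub>R axis k 1) = C t s x + l"
    and C_mono: "0 \<le> x2 - x1 \<Longrightarrow> C T s x1 \<le> C T s x2"
    and C_bound: "t \<le> T \<Longrightarrow>
      \<exists>h. continuous_on UNIV (\<lambda>(s, x). h s x) \<and> (\<forall>s x. \<bar>C t s x\<bar> \<le> h s x)"
    and solvency_mono: "t \<le> T \<Longrightarrow> AE \<omega> in M. \<forall>z\<in>solvency_set S C t \<omega>. \<forall>x\<ge>0.
      z + x \<in> solvency_set S C t \<omega>"
begin

text \<open>The remaining properties of the solvency sets follow from those of the cost functions.\<close>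

lemma uminus_e1_notin_solvency_set:
  assumes "t \<le> T" "\<omega> \<in> space M"
  shows "- axis k 1 \<notin> solvency_set S C t \<omega>"
  using C_cash[OF assms(1), of "S t \<omega>" 0 1] C_zero[OF assms(1) S_nonneg[OF assms]]
  by (simp add: solvency_set_def)

lemma solvency_set_iff:
  assumes "t \<le> T"
  shows "\<alpha> *\<^sub>R axis k 1 - z \<in> solvency_set S C t \<omega> \<longleftrightarrow> C t (S t \<omega>) z \<le> \<alpha>"
  using C_cash[OF assms, of "S t \<omega>" z "- \<alpha>"] by (simp add: solvency_set_def)

lemma cost_eq_Least:
  assumes "t \<le> T"
  shows "C t (S t \<omega>) z = (LEAST \<alpha>. \<alpha> *\<^sub>R axis k 1 - z \<in> solvency_set S C t \<omega>)"
  by (rule sym, rule Least_equality) (simp_all add: solvency_set_iff[OF assms])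

lemma closed_solvency_set:
  assumes "t \<le> T"
  shows "closed (solvency_set S C t \<omega>)"
proof -
  have "open {z. C t (S t \<omega>) (- z) > 0}"
  proof (subst open_subopen, safe)
    fix z assume z: "C t (S t \<omega>) (- z) > 0"
    have "\<forall>\<^sub>F p in nhds (S t \<omega>, - z). 0 < (case p of (s, x) \<Rightarrow> C t s x)"
      using C_lsc[OF assms] z unfolding lsc_def by auto
    moreover have "filterlim (\<lambda>y. (S t \<omega>, - y)) (nhds (S t \<omega>, - z)) (nhds z)"
      by (intro tendsto_Pair tendsto_const tendsto_minus filterlim_ident)
    ultimately have "\<forall>\<^sub>F y in nhds z. 0 < (case (S t \<omega>, - y) of (s, x) \<Rightarrow> C t s x)"
      by (rule eventually_compose_filterlim)
    hence "\<forall>\<^sub>F y in nhds z. 0 < C t (S t \<omega>) (- y)"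
      by simp
    thus "\<exists>U. open U \<and> z \<in> U \<and> U \<subseteq> {z. C t (S t \<omega>) (- z) > 0}"
      unfolding eventually_nhds by blast
  qed
  moreover have "- solvency_set S C t \<omega> = {z. C t (S t \<omega>) (- z) > 0}"
    by (auto simp: solvency_set_def)
  ultimately show ?thesis by (simp add: closed_def)
qed

lemma graph_measurable_solvency_set:
  assumes "t \<le> T"
  shows "{(\<omega>, z) \<in> space (F t \<Otimes>\<^sub>M borel). z \<in> solvency_set S C t \<omega>} \<in> sets (F t \<Otimes>\<^sub>M borel)"
proof -
  have "(\<lambda>p. (S t (fst p), - snd p :: real ^ 'd)) \<in> F t \<Otimes>\<^sub>M borel \<rightarrow>\<^sub>M borel"
    by (intro borel_measurable_Pair borel_measurable_uminus measurable_snd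
        measurable_compose[OF measurable_fst S_measurable[OF assms]])
  from measurable_compose[OF this C_borel[OF assms]]
  have [measurable]: "(\<lambda>p. C t (S t (fst p)) (- snd p)) \<in> borel_measurable (F t \<Otimes>\<^sub>M borel)"
    by simp
  have "{p \<in> space (F t \<Otimes>\<^sub>M borel). C t (S t (fst p)) (- snd p) \<le> 0} \<in> sets (F t \<Otimes>\<^sub>M borel)"
    by measurable
  moreover have "{(\<omega>, z) \<in> space (F t \<Otimes>\<^sub>M borel). z \<in> solvency_set S C t \<omega>}
      = {p \<in> space (F t \<Otimes>\<^sub>M borel). C t (S t (fst p)) (- snd p) \<le> 0}"
    by (auto simp: solvency_set_def)
  ultimately show ?thesis by simp
qed

end

text \<open>Portfolio processes start at time \<open>-1\<close> and are therefore indexed by integers; \<open>F\<^sub>-\<^sub>1 = F\<^sub>0\<close>.\<close>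

definition portfolio_process ::
    "'a measure \<Rightarrow> (nat \<Rightarrow> 'a measure) \<Rightarrow> nat \<Rightarrow> (nat \<Rightarrow> 'a \<Rightarrow> real ^ 'm) \<Rightarrow>
     (nat \<Rightarrow> real ^ 'm \<Rightarrow> real ^ 'd \<Rightarrow> real) \<Rightarrow> 'd \<Rightarrow> (int \<Rightarrow> 'a \<Rightarrow> real ^ 'd) \<Rightarrow> bool" where
  "portfolio_process M F T S C k V \<longleftrightarrow>
     V (- 1) \<in> L0 M (F 0) (range (\<lambda>a. a *\<^sub>R axis k 1)) \<and>
     (\<forall>t\<le>T. V (int t) \<in> borel_measurable (F t) \<and>
        (AE \<omega> in M. V (int t) \<omega> - V (int t - 1) \<omega> \<in> uminus ` solvency_set S C t \<omega>))"

definition hedgeable ::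
    "'a measure \<Rightarrow> (nat \<Rightarrow> 'a measure) \<Rightarrow> nat \<Rightarrow> (nat \<Rightarrow> 'a \<Rightarrow> real ^ 'm) \<Rightarrow>
     (nat \<Rightarrow> real ^ 'm \<Rightarrow> real ^ 'd \<Rightarrow> real) \<Rightarrow> 'd \<Rightarrow> ('a \<Rightarrow> real ^ 'd) \<Rightarrow> bool" where
  "hedgeable M F T S C k \<xi> \<longleftrightarrow>
     (\<exists>V. portfolio_process M F T S C k V \<and> (AE \<omega> in M. V (int T) \<omega> = \<xi> \<omega>))"

definition super_homogeneous ::
    "nat \<Rightarrow> (nat \<Rightarrow> real ^ 'm \<Rightarrow> real ^ 'd \<Rightarrow> real) \<Rightarrow> (ennreal \<Rightarrow> ennreal) \<Rightarrow> bool" where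
  "super_homogeneous T C \<delta> \<longleftrightarrow>
     mono \<delta> \<and> bij \<delta> \<and> \<delta> 0 = 0 \<and> \<delta> \<infinity> = \<infinity> \<and>
     (\<forall>t\<le>T. \<forall>l\<ge>1. \<forall>s\<ge>0. \<forall>x.
        ereal (C t s (l *\<^sub>R x)) \<ge> enn2ereal (\<delta> (ennreal l)) * ereal (C t s x))"


section \<open>Hedging costs\<close>

text \<open>The set \<open>\<Pi>\<^sub>t\<^sup>T(v, \<xi>)\<close>, where \<open>v\<close> is the position at time \<open>t - 1\<close>.\<close>

definition strategies ::
    "'a measure \<Rightarrow> (nat \<Rightarrow> 'a measure) \<Rightarrow> nat \<Rightarrow> 'd \<Rightarrow> ('a \<Rightarrow> real ^ 'd) \<Rightarrow> nat \<Rightarrow>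
     ('a \<Rightarrow> real ^ 'd) \<Rightarrow> (int \<Rightarrow> 'a \<Rightarrow> real ^ 'd) set" where
  "strategies M F T k \<xi> t v =
     {V. V (int t - 1) = (\<lambda>\<omega>. noncash k (v \<omega>)) \<and>
         (\<forall>s\<in>{t..<T}. V (int s) \<in> L0 M (F s) (noncash_space k)) \<and>
         V (int T) = (\<lambda>\<omega>. noncash k (\<xi> \<omega>))}"

definition hedging_cost ::
    "'a measure \<Rightarrow> (nat \<Rightarrow> 'a measure) \<Rightarrow> nat \<Rightarrow> (nat \<Rightarrow> 'a \<Rightarrow> real ^ 'm) \<Rightarrow>
     (nat \<Rightarrow> real ^ 'm \<Rightarrow> real ^ 'd \<Rightarrow> real) \<Rightarrow> 'd \<Rightarrow> ('a \<Rightarrow> real ^ 'd) \<Rightarrow> nat \<Rightarrow>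
     ('a \<Rightarrow> real ^ 'd) \<Rightarrow> 'a \<Rightarrow> ereal" where
  "hedging_cost M F T S C k \<xi> t v =
     ess_inf M (F t)
       ((\<lambda>V. ess_sup M (F t)
           {\<lambda>\<omega>. ereal (\<xi> \<omega> $ k +
              (\<Sum>s=t..T. C s (S s \<omega>) (noncash k (V (int s) \<omega> - V (int s - 1) \<omega>))))})
        ` strategies M F T k \<xi> t v)"

definition theta ::
    "'a measure \<Rightarrow> (nat \<Rightarrow> 'a measure) \<Rightarrow> nat \<Rightarrow> (nat \<Rightarrow> 'a \<Rightarrow> real ^ 'm) \<Rightarrow>
     (nat \<Rightarrow> real ^ 'm \<Rightarrow> real ^ 'd \<Rightarrow> real) \<Rightarrow> 'd \<Rightarrow> ('a \<Rightarrow> real ^ 'd) \<Rightarrow> nat \<Rightarrow>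
     ('a \<Rightarrow> real ^ 'd) \<Rightarrow> 'a \<Rightarrow> ereal" where
  "theta M F T S C k \<xi> t v = ess_sup M (F t) {hedging_cost M F T S C k \<xi> (Suc t) v}"

text \<open>
  \<open>\<theta>'\<close> is a pointwise version of \<open>\<theta>\<^sub>t\<^sup>\<xi>\<close>: a normal integrand that represents it on all
  \<open>F\<^sub>t\<close>-measurable positions. It is what allows \<open>D\<^sub>t\<^sup>\<xi>\<close> to be evaluated, for fixed \<open>\<omega>\<close>, at
  uncountably many deterministic positions simultaneously.
\<close>

definition theta_version ::
    "'a measure \<Rightarrow> (nat \<Rightarrow> 'a measure) \<Rightarrow> nat \<Rightarrow> (nat \<Rightarrow> 'a \<Rightarrow> real ^ 'm) \<Rightarrow>
     (nat \<Rightarrow> real ^ 'm \<Rightarrow> real ^ 'd \<Rightarrow> real) \<Rightarrow> 'd \<Rightarrow> ('a \<Rightarrow> real ^ 'd) \<Rightarrow> nat \<Rightarrow>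
     ('a \<Rightarrow> real ^ 'd \<Rightarrow> ereal) \<Rightarrow> bool" where
  "theta_version M F T S C k \<xi> t \<theta>' \<longleftrightarrow>
     normal_integrand (F t) \<theta>' \<and>
     (\<forall>V\<in>L0 M (F t) UNIV. AE \<omega> in M. theta M F T S C k \<xi> t V \<omega> = \<theta>' \<omega> (V \<omega>))"

definition D_pointwise ::
    "(nat \<Rightarrow> real ^ 'm \<Rightarrow> real ^ 'd \<Rightarrow> real) \<Rightarrow> 'd \<Rightarrow> nat \<Rightarrow> ('a \<Rightarrow> real ^ 'd \<Rightarrow> ereal) \<Rightarrow>
     'a \<Rightarrow> real ^ 'm \<Rightarrow> real ^ 'd \<Rightarrow> real ^ 'd \<Rightarrow> ereal" where
  "D_pointwise C k t \<theta>' \<omega> s v z = ereal (C t s (noncash k (z - v))) + \<theta>' \<omega> z"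

end

theory Submission
  imports Defs
begin

text \<open>
  A family of random variables \<open>\<Phi> V\<close>, indexed by the \<open>\<F>\<^sub>t\<close>-measurable positions \<open>V\<close>, comes from a
  normal integrand as soon as it is local (\<open>\<Phi> V\<close> on an event depends only on \<open>V\<close> on that event)
  and its sublevel families \<open>{V. \<Phi> V \<le> Y}\<close>, for measurable \<open>Y\<close>, are closed under pointwise limits.
  The integrand is built from the essential infima of \<open>\<Phi>\<close> over countably many small balls
  (\<open>normal_integrand_representation\<close>), which avoids infima over uncountably many positions and with
  them the measurability of projections. Since the price variable is only ever evaluated at \<open>S\<^sub>t\<close>,
  an integrand in the position alone extends to one in price and position that is infinite off the graph of \<open>S\<^sub>t\<close>
  (\<open>normal_integrand_on_graph\<close>). It therefore suffices that \<open>\<gamma>\<^sub>t\<close> is local, which follows by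
  pasting strategies, and has closed sublevel families.

  For closedness, let \<open>v\<^sub>j \<longlonglongrightarrow> v\<close> and \<open>\<gamma>\<^sub>t(v\<^sub>j) \<le> Y\<close>. Pasting countably many strategies along measurable
  events turns each of these inequalities into one strategy whose total cost is below a slightly
  larger bound almost surely (\<open>ex_strategy_of_hedging_cost_less\<close>). Let \<open>w\<^sub>j\<close> be its position at time
  \<open>t\<close>; what the bound leaves after the trade at time \<open>t\<close> dominates \<open>\<gamma>\<^sub>t\<^sub>+\<^sub>1(w\<^sub>j)\<close>. If the
  sequence \<open>w\<^sub>j\<close> is bounded at almost every outcome with \<open>Y < \<infinity>\<close>, it has an \<open>\<F>\<^sub>t\<close>-measurable cluster point \<open>W\<close> (\<open>measurable_cluster_point\<close>),
  lower semicontinuity of \<open>C\<^sub>t\<close> and of the integrand of \<open>\<gamma>\<^sub>t\<^sub>+\<^sub>1\<close> passes the bound to \<open>W\<close>, and prepending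
  \<open>W\<close> to a nearly optimal continuation gives \<open>\<gamma>\<^sub>t(v) \<le> Y\<close>
  (\<open>hedging_cost_sublevel_closed\<close>).

  Boundedness is where the assumption on \<open>D\<^sup>0\<close> enters (\<open>strategy_position_bound\<close>). Because \<open>\<xi> \<ge> 0\<close> and
  \<open>C\<^sub>T\<close> is monotone, delivering \<open>0\<close> in place of \<open>\<xi>\<close> costs no more; dividing the continuation by \<open>\<bar>w\<bar> \<ge> 1\<close>
  then gives \<open>\<delta>(\<bar>w\<bar>) \<theta>\<^sup>0(w/\<bar>w\<bar>) \<le> Y - C\<^sub>t(w - v)\<close>, and super- or sub-additivity lets \<open>C\<^sub>t(w - v)\<close> be replaced
  by \<open>C\<^sub>t(w)\<close> up to a term depending on \<open>v\<close> only. Hence \<open>\<delta>(\<bar>w\<bar>) D\<^sup>0(w/\<bar>w\<bar>)\<close> is bounded, and as \<open>D\<^sup>0\<close> is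
  bounded away from zero on the sphere and \<open>\<delta>\<close> grows to infinity, so is \<open>w\<close>.
\<close>

section \<open>Essential bounds of families of random variables\<close>

text \<open>
  A bounded, strictly increasing gauge of extended reals: comparing expectations of the gauge
  detects strict inequalities on events of positive probability, infinite values included.
\<close>

definition arctan_ereal :: "ereal \<Rightarrow> real" where
  "arctan_ereal x =
     (if x = \<infinity> then pi / 2 else if x = - \<infinity> then - (pi / 2) else arctan (real_of_ereal x))"

lemma arctan_ereal_less: "x < y \<Longrightarrow> arctan_ereal x < arctan_ereal y"
  using arctan_lbound arctan_ubound
  by (cases x; cases y) (auto simp: arctan_ereal_def arctan_less_iff)

lemma arctan_ereal_le: "x \<le> y \<Longrightarrow> arctan_ereal x \<le> arctan_ereal y"
  using arctan_ereal_less[of x y] by (cases "x = y") (auto simp: less_le)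

lemma abs_arctan_ereal_le: "\<bar>arctan_ereal x\<bar> \<le> pi / 2"
  using arctan_lbound[of "real_of_ereal x"] arctan_ubound[of "real_of_ereal x"]
  by (auto simp: arctan_ereal_def)

lemma borel_measurable_arctan_ereal [measurable]: "arctan_ereal \<in> borel_measurable borel"
  unfolding arctan_ereal_def by measurable

text \<open>
  A countable subfamily whose infimum minimises the expected gauge cannot be improved by
  adjoining one more member, so its infimum lies below every member almost surely.
\<close>

lemma (in prob_space) ess_inf_eq_countable_INF:
  assumes G: "subalgebra M G" and XS: "XS \<subseteq> borel_measurable G" "XS \<noteq> {}"
  obtains X :: "nat \<Rightarrow> 'a \<Rightarrow> ereal"
  where "range X \<subseteq> XS" "is_ess_inf M G XS (\<lambda>\<omega>. INF n. X n \<omega>)"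
proof -
  define c where "c X = (\<integral>\<omega>. arctan_ereal (INF n. X n \<omega>) \<partial>M)" for X :: "nat \<Rightarrow> 'a \<Rightarrow> ereal"
  define P where "P = {X :: nat \<Rightarrow> 'a \<Rightarrow> ereal. range X \<subseteq> XS}"
  have meas_G: "(\<lambda>\<omega>. INF n. X n \<omega>) \<in> borel_measurable G" if "X \<in> P" for X
  proof (rule borel_measurable_INF)
    fix n show "X n \<in> borel_measurable G" using that XS by (auto simp: P_def)
  qed simp
  have int: "integrable M (\<lambda>\<omega>. arctan_ereal (INF n. X n \<omega>))" if "X \<in> P" for X
  proof (rule integrable_const_bound[where B = "pi / 2"])
    have [measurable]: "(\<lambda>\<omega>. INF n. X n \<omega>) \<in> borel_measurable M"
      by (rule measurable_from_subalg[OF G meas_G[OF that]])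
    show "(\<lambda>\<omega>. arctan_ereal (INF n. X n \<omega>)) \<in> borel_measurable M" by measurable
    show "AE \<omega> in M. norm (arctan_ereal (INF n. X n \<omega>)) \<le> pi / 2"
      unfolding real_norm_def by (intro AE_I2 abs_arctan_ereal_le)
  qed
  have c_mono: "c X \<le> c Y" if "X \<in> P" "Y \<in> P" "\<And>\<omega>. (INF n. X n \<omega>) \<le> (INF n. Y n \<omega>)" for X Y
    unfolding c_def by (intro integral_mono int that arctan_ereal_le)
  obtain X0 where "X0 \<in> XS" using XS by auto
  then have P_ne: "P \<noteq> {}" by (auto simp: P_def intro!: exI[of _ "\<lambda>_. X0"])
  have bdd: "bdd_below (c ` P)"
  proof (rule bdd_belowI2)
    fix X assume "X \<in> P"
    have "(\<integral>\<omega>. - (pi / 2) \<partial>M) \<le> c X"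
      unfolding c_def
    proof (intro integral_mono int \<open>X \<in> P\<close>)
      show "- (pi / 2) \<le> arctan_ereal (INF n. X n \<omega>)" for \<omega>
        using abs_arctan_ereal_le[of "INF n. X n \<omega>"] by linarith
    qed simp
    then show "- (pi / 2) \<le> c X" by (simp add: prob_space)
  qed
  have "\<exists>X\<in>P. c X < (INF X\<in>P. c X) + 1 / (real j + 1)" for j
    by (subst cINF_less_iff[OF P_ne bdd, symmetric]) simp
  then obtain f where f: "\<And>j. f j \<in> P" "\<And>j. c (f j) < (INF X\<in>P. c X) + 1 / (real j + 1)"
    by metis
  \<comment> \<open>one subfamily that contains every subfamily of the minimising sequence\<close>
  define g where "g n = f (fst (prod_decode n)) (snd (prod_decode n))" for n
  have gP: "g \<in> P" using f(1) by (force simp: g_def P_def)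
  have g_le: "(INF n. g n \<omega>) \<le> (INF n. f j n \<omega>)" for j \<omega>
  proof (rule INF_greatest)
    fix n show "(INF n. g n \<omega>) \<le> f j n \<omega>"
      by (rule INF_lower2[of "prod_encode (j, n)"]) (simp_all add: g_def)
  qed
  have c_g: "c g \<le> (INF X\<in>P. c X)"
  proof (rule field_le_epsilon)
    fix e :: real assume "0 < e"
    then obtain j where j: "1 / (real j + 1) < e"
      using reals_Archimedean[of e] by (auto simp: inverse_eq_divide add_ac)
    have "c g \<le> c (f j)" by (rule c_mono[OF gP f(1) g_le])
    then show "c g \<le> (INF X\<in>P. c X) + e" using f(2)[of j] j by linarith
  qed
  have "AE \<omega> in M. (INF n. g n \<omega>) \<le> X \<omega>" if "X \<in> XS" for X
  proof -
    define h where "h = (\<lambda>n. case n of 0 \<Rightarrow> X | Suc n \<Rightarrow> g n)"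
    have hP: "h \<in> P" using that gP by (auto simp: h_def P_def image_subset_iff split: nat.split)
    have h_le_g: "(INF n. h n \<omega>) \<le> (INF n. g n \<omega>)" for \<omega>
    proof (rule INF_greatest)
      fix n show "(INF n. h n \<omega>) \<le> g n \<omega>"
        by (rule INF_lower2[of "Suc n"]) (simp_all add: h_def)
    qed
    have h_le_X: "(INF n. h n \<omega>) \<le> X \<omega>" for \<omega>
      by (rule INF_lower2[of 0]) (simp_all add: h_def)
    let ?D = "\<lambda>\<omega>. arctan_ereal (INF n. g n \<omega>) - arctan_ereal (INF n. h n \<omega>)"
    have D0: "0 \<le> ?D \<omega>" for \<omega> using arctan_ereal_le[OF h_le_g[of \<omega>]] by simp
    have "(INF X\<in>P. c X) \<le> c h" by (rule cINF_lower[OF bdd hP])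
    then have "(\<integral>\<omega>. ?D \<omega> \<partial>M) \<le> 0"
      using c_g int[OF gP] int[OF hP] by (simp add: c_def)
    moreover have "0 \<le> (\<integral>\<omega>. ?D \<omega> \<partial>M)" by (intro integral_nonneg_AE AE_I2 D0)
    ultimately have "(\<integral>\<omega>. ?D \<omega> \<partial>M) = 0" by simp
    then have "AE \<omega> in M. ?D \<omega> = 0"
      using integral_nonneg_eq_0_iff_AE[of M ?D] D0 int[OF gP] int[OF hP] by simp
    then show ?thesis
    proof eventually_elim
      case (elim \<omega>)
      then have "\<not> (INF n. h n \<omega>) < (INF n. g n \<omega>)"
        using arctan_ereal_less[of "INF n. h n \<omega>" "INF n. g n \<omega>"] by auto
      then show ?case using h_le_X[of \<omega>] by auto
    qed
  qed
  moreover have "AE \<omega> in M. Z \<omega> \<le> (INF n. g n \<omega>)"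
    if "\<forall>X\<in>XS. AE \<omega> in M. Z \<omega> \<le> X \<omega>" for Z
  proof -
    have "\<forall>n. AE \<omega> in M. Z \<omega> \<le> g n \<omega>" using that gP by (auto simp: P_def)
    then have "AE \<omega> in M. \<forall>n. Z \<omega> \<le> g n \<omega>" by (simp add: AE_all_countable)
    then show ?thesis by eventually_elim (auto intro: INF_greatest)
  qed
  ultimately have "is_ess_inf M G XS (\<lambda>\<omega>. INF n. g n \<omega>)"
    using meas_G[OF gP] by (auto simp: is_ess_inf_def)
  then show thesis using that gP by (auto simp: P_def)
qed

lemma (in prob_space) is_ess_inf_ess_inf:
  assumes "subalgebra M G" "XS \<subseteq> borel_measurable G" "XS \<noteq> {}"
  shows "is_ess_inf M G XS (ess_inf M G XS)"
  unfolding ess_inf_def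
  by (rule ess_inf_eq_countable_INF[OF assms]) (rule someI[of "is_ess_inf M G XS"])

text \<open>
  The essential supremum is the essential infimum of the measurable upper bounds; it is again an
  upper bound because countably many upper bounds attain it.
\<close>

lemma (in prob_space) is_ess_sup_ess_sup:
  assumes G: "subalgebra M G"
  shows "is_ess_sup M G XS (ess_sup M G XS)"
proof -
  define ZS where "ZS = {Z \<in> borel_measurable G. \<forall>X\<in>XS. AE \<omega> in M. X \<omega> \<le> Z \<omega>}"
  have "ZS \<subseteq> borel_measurable G" by (auto simp: ZS_def)
  moreover have "(\<lambda>_. \<infinity>) \<in> ZS" by (simp add: ZS_def)
  then have "ZS \<noteq> {}" by blast
  ultimately obtain Z :: "nat \<Rightarrow> 'a \<Rightarrow> ereal"
    where Z: "range Z \<subseteq> ZS" "is_ess_inf M G ZS (\<lambda>\<omega>. INF n. Z n \<omega>)"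
    by (rule ess_inf_eq_countable_INF[OF G])
  have "AE \<omega> in M. X \<omega> \<le> (INF n. Z n \<omega>)" if "X \<in> XS" for X
  proof -
    have "\<forall>n. AE \<omega> in M. X \<omega> \<le> Z n \<omega>" using Z(1) that by (auto simp: ZS_def)
    then have "AE \<omega> in M. \<forall>n. X \<omega> \<le> Z n \<omega>" by (simp add: AE_all_countable)
    then show ?thesis by eventually_elim (auto intro: INF_greatest)
  qed
  then have "is_ess_sup M G XS (\<lambda>\<omega>. INF n. Z n \<omega>)"
    using Z(2) by (auto simp: is_ess_sup_def is_ess_inf_def ZS_def)
  then show ?thesis unfolding ess_sup_def by (rule someI[of "is_ess_sup M G XS"])
qed

section \<open>Measurable selection of cluster points\<close>

text \<open>
  The limes inferior is a measurable limit point, and the successive first times at which the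
  sequence comes close to it are measurable.
\<close>

lemma measurable_real_subsequence:
  fixes Y :: "nat \<Rightarrow> 'a \<Rightarrow> real"
  assumes [measurable]: "\<And>n. Y n \<in> borel_measurable G"
  obtains \<sigma> :: "nat \<Rightarrow> 'a \<Rightarrow> nat"
  where "\<And>j. \<sigma> j \<in> measurable G (count_space UNIV)"
    and "\<And>\<omega>. Bseq (\<lambda>n. Y n \<omega>) \<Longrightarrow> strict_mono (\<lambda>j. \<sigma> j \<omega>) \<and> convergent (\<lambda>j. Y (\<sigma> j \<omega>) \<omega>)"
proof -
  define L where "L \<omega> = real_of_ereal (liminf (\<lambda>n. ereal (Y n \<omega>)))" for \<omega>
  have [measurable]: "L \<in> borel_measurable G" unfolding L_def by measurable
  define \<sigma> where "\<sigma> = rec_nat (\<lambda>\<omega>. 0)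
    (\<lambda>j f \<omega>. LEAST n. f \<omega> < n \<and> \<bar>Y n \<omega> - L \<omega>\<bar> < 1 / real (Suc j))"
  have \<sigma>_Suc: "\<sigma> (Suc j) \<omega> = (LEAST n. \<sigma> j \<omega> < n \<and> \<bar>Y n \<omega> - L \<omega>\<bar> < 1 / real (Suc j))" for j \<omega>
    by (simp add: \<sigma>_def)
  have meas: "\<sigma> j \<in> measurable G (count_space UNIV)" for j
  proof (induction j)
    case 0 show ?case by (simp add: \<sigma>_def)
  next
    case (Suc j)
    note [measurable] = Suc
    have "(\<lambda>\<omega>. LEAST n. \<sigma> j \<omega> < n \<and> \<bar>Y n \<omega> - L \<omega>\<bar> < 1 / real (Suc j))
        \<in> measurable G (count_space UNIV)" by measurable
    then show ?case by (simp add: \<sigma>_Suc[abs_def])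
  qed
  moreover have "strict_mono (\<lambda>j. \<sigma> j \<omega>) \<and> convergent (\<lambda>j. Y (\<sigma> j \<omega>) \<omega>)"
    if bdd: "Bseq (\<lambda>n. Y n \<omega>)" for \<omega>
  proof -
    obtain K where K: "\<And>n. \<bar>Y n \<omega>\<bar> \<le> K"
      using bdd by (auto simp: Bseq_def)
    have "ereal (- K) \<le> liminf (\<lambda>n. ereal (Y n \<omega>))"
      by (rule Liminf_bounded) (use K in \<open>auto simp: abs_le_iff minus_le_iff\<close>)
    moreover have "liminf (\<lambda>n. ereal (Y n \<omega>)) \<le> ereal K"
      by (rule Liminf_le) (use K in \<open>auto simp: abs_le_iff\<close>)
    ultimately have lim: "liminf (\<lambda>n. ereal (Y n \<omega>)) = ereal (L \<omega>)"
      unfolding L_def by (cases "liminf (\<lambda>n. ereal (Y n \<omega>))") auto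
    obtain r where r: "strict_mono r" "((\<lambda>n. ereal (Y n \<omega>)) \<circ> r) \<longlonglongrightarrow> ereal (L \<omega>)"
      using liminf_subseq_lim[of "\<lambda>n. ereal (Y n \<omega>)"] unfolding lim by blast
    have rlim: "(\<lambda>n. Y (r n) \<omega>) \<longlonglongrightarrow> L \<omega>" using r(2) by (simp add: o_def)
    have ex: "\<exists>n>N. \<bar>Y n \<omega> - L \<omega>\<bar> < e" if "0 < e" for N e
    proof -
      have "\<forall>\<^sub>F n in sequentially. \<bar>Y (r n) \<omega> - L \<omega>\<bar> < e"
        using tendstoD[OF rlim that] by (simp add: dist_real_def)
      then have "\<forall>\<^sub>F n in sequentially. \<bar>Y (r n) \<omega> - L \<omega>\<bar> < e \<and> N < n"
        using eventually_gt_at_top by (rule eventually_conj)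
      then obtain n where "\<bar>Y (r n) \<omega> - L \<omega>\<bar> < e" "N < n"
        using eventually_happens'[OF sequentially_bot] by blast
      then show ?thesis using seq_suble[OF r(1), of n] by (intro exI[of _ "r n"]) auto
    qed
    have step: "\<sigma> j \<omega> < \<sigma> (Suc j) \<omega> \<and> \<bar>Y (\<sigma> (Suc j) \<omega>) \<omega> - L \<omega>\<bar> < 1 / real (Suc j)" for j
      unfolding \<sigma>_Suc by (rule LeastI_ex) (rule ex, simp)
    have "(\<lambda>j. Y (\<sigma> (Suc j) \<omega>) \<omega> - L \<omega>) \<longlonglongrightarrow> 0"
    proof (rule Lim_null_comparison[OF _ LIMSEQ_inverse_real_of_nat])
      show "\<forall>\<^sub>F j in sequentially. norm (Y (\<sigma> (Suc j) \<omega>) \<omega> - L \<omega>) \<le> inverse (real (Suc j))"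
        using step by (intro always_eventually allI) (auto simp: inverse_eq_divide intro: less_imp_le)
    qed
    then have "(\<lambda>j. Y (\<sigma> j \<omega>) \<omega>) \<longlonglongrightarrow> L \<omega>"
      by (subst filterlim_sequentially_Suc[symmetric]) (simp add: LIM_zero_cancel)
    then show ?thesis using step by (auto simp: strict_mono_Suc_iff convergent_def)
  qed
  ultimately show thesis by (rule that)
qed

text \<open>
  Coordinate by coordinate: a random subsequence of a random subsequence is one again, and
  convergence of the coordinates already treated survives thinning.
\<close>

lemma measurable_convergent_subsequence:
  fixes X :: "nat \<Rightarrow> 'a \<Rightarrow> 'b::euclidean_space"
  assumes X [measurable]: "\<And>n. X n \<in> borel_measurable G" and "finite I"
  shows "\<exists>\<tau> :: nat \<Rightarrow> 'a \<Rightarrow> nat. (\<forall>j. \<tau> j \<in> measurable G (count_space UNIV)) \<and>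
    (\<forall>\<omega>. Bseq (\<lambda>n. X n \<omega>) \<longrightarrow>
      strict_mono (\<lambda>j. \<tau> j \<omega>) \<and> (\<forall>b\<in>I. convergent (\<lambda>j. X (\<tau> j \<omega>) \<omega> \<bullet> b)))"
  using \<open>finite I\<close>
proof induction
  case empty
  show ?case by (intro exI[of _ "\<lambda>j \<omega>. j"]) (simp add: strict_mono_def)
next
  case (insert b I)
  obtain \<tau> where \<tau>[measurable]: "\<And>j. \<tau> j \<in> measurable G (count_space UNIV)"
    and \<tau>_conv: "\<And>\<omega>. Bseq (\<lambda>n. X n \<omega>) \<Longrightarrow>
      strict_mono (\<lambda>j. \<tau> j \<omega>) \<and> (\<forall>b\<in>I. convergent (\<lambda>j. X (\<tau> j \<omega>) \<omega> \<bullet> b))"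
    using insert.IH by blast
  have "(\<lambda>\<omega>. X (\<tau> j \<omega>) \<omega>) \<in> borel_measurable G" for j
    by (rule measurable_compose_countable[OF X \<tau>])
  then have "(\<lambda>\<omega>. X (\<tau> j \<omega>) \<omega> \<bullet> b) \<in> borel_measurable G" for j
    by (intro borel_measurable_inner borel_measurable_const)
  then obtain \<sigma> where \<sigma>[measurable]: "\<And>j. \<sigma> j \<in> measurable G (count_space UNIV)"
    and \<sigma>_conv: "\<And>\<omega>. Bseq (\<lambda>n. X (\<tau> n \<omega>) \<omega> \<bullet> b) \<Longrightarrow>
      strict_mono (\<lambda>j. \<sigma> j \<omega>) \<and> convergent (\<lambda>j. X (\<tau> (\<sigma> j \<omega>) \<omega>) \<omega> \<bullet> b)"
    by (rule measurable_real_subsequence[of "\<lambda>j \<omega>. X (\<tau> j \<omega>) \<omega> \<bullet> b"]) blast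
  have "(\<lambda>\<omega>. \<tau> (\<sigma> j \<omega>) \<omega>) \<in> measurable G (count_space UNIV)" for j
    by (rule measurable_compose_countable[OF \<tau> \<sigma>])
  moreover have "strict_mono (\<lambda>j. \<tau> (\<sigma> j \<omega>) \<omega>) \<and>
      (\<forall>b\<in>insert b I. convergent (\<lambda>j. X (\<tau> (\<sigma> j \<omega>) \<omega>) \<omega> \<bullet> b))"
    if bdd: "Bseq (\<lambda>n. X n \<omega>)" for \<omega>
  proof -
    obtain K where K: "\<And>n. norm (X n \<omega>) \<le> K" using bdd by (auto simp: Bseq_def)
    have "norm (X (\<tau> n \<omega>) \<omega> \<bullet> b) \<le> K * norm b" for n
      using order_trans[OF Cauchy_Schwarz_ineq2 mult_right_mono[OF K norm_ge_zero]] by simp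
    then have "Bseq (\<lambda>n. X (\<tau> n \<omega>) \<omega> \<bullet> b)" by (rule BseqI')
    note \<sigma>' = \<sigma>_conv[OF this] and \<tau>' = \<tau>_conv[OF bdd]
    have "strict_mono (\<lambda>j. \<tau> (\<sigma> j \<omega>) \<omega>)"
      using \<sigma>' \<tau>' by (auto simp: strict_mono_def)
    moreover have "convergent (\<lambda>j. X (\<tau> (\<sigma> j \<omega>) \<omega>) \<omega> \<bullet> c)" if "c \<in> I" for c
      using convergent_subseq_convergent[of "\<lambda>j. X (\<tau> j \<omega>) \<omega> \<bullet> c" "\<lambda>j. \<sigma> j \<omega>"] \<sigma>' \<tau>' that
      by (simp add: o_def)
    ultimately show ?thesis using \<sigma>' by auto
  qed
  ultimately show ?case by (intro exI[of _ "\<lambda>j \<omega>. \<tau> (\<sigma> j \<omega>) \<omega>"]) blast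
qed

lemma measurable_cluster_point:
  fixes X :: "nat \<Rightarrow> 'a \<Rightarrow> 'b::euclidean_space"
  assumes X: "\<And>n. X n \<in> borel_measurable G"
  obtains W where "W \<in> borel_measurable G"
    and "\<And>\<omega>. Bseq (\<lambda>n. X n \<omega>) \<Longrightarrow> \<exists>r. strict_mono r \<and> (\<lambda>j. X (r j) \<omega>) \<longlonglongrightarrow> W \<omega>"
proof -
  obtain \<tau> :: "nat \<Rightarrow> 'a \<Rightarrow> nat" where \<tau>: "\<And>j. \<tau> j \<in> measurable G (count_space UNIV)"
    and conv: "\<And>\<omega>. Bseq (\<lambda>n. X n \<omega>) \<Longrightarrow>
      strict_mono (\<lambda>j. \<tau> j \<omega>) \<and> (\<forall>b\<in>Basis. convergent (\<lambda>j. X (\<tau> j \<omega>) \<omega> \<bullet> b))"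
    using measurable_convergent_subsequence[of X, OF X finite_Basis] by blast
  show thesis
  proof (rule that)
    show "(\<lambda>\<omega>. lim (\<lambda>j. X (\<tau> j \<omega>) \<omega>)) \<in> borel_measurable G"
      by (intro borel_measurable_lim_metric measurable_compose_countable[OF X \<tau>])
  next
    fix \<omega> assume bdd: "Bseq (\<lambda>n. X n \<omega>)"
    then obtain l where l: "\<And>b. b \<in> Basis \<Longrightarrow> (\<lambda>j. X (\<tau> j \<omega>) \<omega> \<bullet> b) \<longlonglongrightarrow> l b"
      using conv[OF bdd] unfolding convergent_def by metis
    have "(\<lambda>j. X (\<tau> j \<omega>) \<omega>) \<longlonglongrightarrow> (\<Sum>b\<in>Basis. l b *\<^sub>R b)"
      by (subst tendsto_componentwise_iff) (auto simp: l)
    then have "(\<lambda>j. X (\<tau> j \<omega>) \<omega>) \<longlonglongrightarrow> lim (\<lambda>j. X (\<tau> j \<omega>) \<omega>)"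
      by (simp add: limI)
    then show "\<exists>r. strict_mono r \<and> (\<lambda>j. X (r j) \<omega>) \<longlonglongrightarrow> lim (\<lambda>j. X (\<tau> j \<omega>) \<omega>)"
      using conv[OF bdd] by blast
  qed
qed

section \<open>Normal integrands\<close>

text \<open>
  A measurable way to exceed every value below infinity strictly, with a bound that is never
  \<open>-\<infinity>\<close> and decreases to the original value. It plays the role of adding \<open>\<epsilon>\<close> where a value may be
  \<open>-\<infinity>\<close>.
\<close>

definition loosen :: "nat \<Rightarrow> ereal \<Rightarrow> ereal" where
  "loosen l c = max c (ereal (- real (Suc l))) + ereal (1 / real (Suc l))"

lemma borel_measurable_loosen [measurable]: "loosen l \<in> borel_measurable borel"
  unfolding loosen_def by measurable

lemma loosen_gt: "c < \<infinity> \<Longrightarrow> c < loosen l c"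
proof (cases c)
  case (real r)
  have "0 < 1 / real (Suc l)" by simp
  then have "r < max r (- real (Suc l)) + 1 / real (Suc l)" by linarith
  then show ?thesis by (simp add: loosen_def real flip: ereal_max)
qed (simp_all add: loosen_def)

lemma loosen_noninf: "loosen l c \<noteq> - \<infinity>"
  by (cases c) (auto simp: loosen_def max_def)

lemma loosen_eq_infinity_iff: "loosen l c = \<infinity> \<longleftrightarrow> c = \<infinity>"
  by (cases c) (auto simp: loosen_def max_def)

lemma le_of_le_loosen:
  assumes "\<And>l. x \<le> loosen l c"
  shows "x \<le> c"
proof (cases c)
  case (real r)
  show ?thesis
  proof (rule ereal_le_epsilon2)
    fix e :: real assume "0 < e"
    obtain l1 where l1: "inverse (real (Suc l1)) < e" using reals_Archimedean[OF \<open>0 < e\<close>] by auto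
    obtain l2 :: nat where l2: "\<bar>r\<bar> < real l2" using reals_Archimedean2 by blast
    define l where "l = max l1 l2"
    have "1 / real (Suc l) \<le> inverse (real (Suc l1))"
      by (simp add: l_def inverse_eq_divide frac_le)
    moreover have "- real (Suc l) \<le> r" using l2 by (simp add: l_def)
    ultimately have "loosen l c \<le> ereal (r + e)"
      using l1 real by (simp add: loosen_def max_def)
    then show "x \<le> c + ereal e" using order_trans[OF assms[of l]] real by simp
  qed
next
  case MInf
  have "x \<le> ereal B" for B
  proof -
    obtain l :: nat where l: "\<bar>B\<bar> < real l" using reals_Archimedean2 by blast
    have "1 / real (Suc l) \<le> 1" by simp
    then have "- real (Suc l) + 1 / real (Suc l) \<le> B" using l by linarith
    then have "loosen l c \<le> ereal B" using MInf by (simp add: loosen_def)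
    then show ?thesis using order_trans[OF assms[of l]] by blast
  qed
  then show ?thesis using ereal_bot[of x] by simp
qed simp

text \<open>
  At a point \<open>v\<close> the integrand is the supremum, over those of countably many balls that contain
  \<open>v\<close>, of the essential infimum of \<open>\<Phi>\<close> over the random variables with values in the ball; such a supremum
  is lower semicontinuous and measurable by construction. It lies below \<open>\<Phi>\<close> by locality. Conversely,
  near-minimisers in shrinking balls around \<open>V\<close>, pasted along the countably many balls, converge to
  \<open>V\<close> and keep \<open>\<Phi>\<close> below the bound, so closedness applies.
\<close>

lemma (in prob_space) normal_integrand_representation:
  fixes \<Phi> :: "('a \<Rightarrow> 'b::{metric_space, second_countable_topology}) \<Rightarrow> 'a \<Rightarrow> ereal"
  assumes G: "subalgebra M G"
    and meas: "\<And>V. V \<in> borel_measurable G \<Longrightarrow> \<Phi> V \<in> borel_measurable G"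
    and local: "\<And>V W A. V \<in> borel_measurable G \<Longrightarrow> W \<in> borel_measurable G \<Longrightarrow> A \<in> sets G \<Longrightarrow>
      (\<And>\<omega>. \<omega> \<in> A \<Longrightarrow> V \<omega> = W \<omega>) \<Longrightarrow> AE \<omega> in M. \<omega> \<in> A \<longrightarrow> \<Phi> V \<omega> = \<Phi> W \<omega>"
    and closed: "\<And>V W Y. (\<And>j. V j \<in> borel_measurable G) \<Longrightarrow> W \<in> borel_measurable G \<Longrightarrow>
      Y \<in> borel_measurable G \<Longrightarrow> (\<And>\<omega>. (\<lambda>j. V j \<omega>) \<longlonglongrightarrow> W \<omega>) \<Longrightarrow>
      (\<And>j. AE \<omega> in M. \<Phi> (V j) \<omega> \<le> Y \<omega>) \<Longrightarrow> AE \<omega> in M. \<Phi> W \<omega> \<le> Y \<omega>"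
  obtains \<theta> where "normal_integrand G \<theta>"
    and "\<And>V. V \<in> borel_measurable G \<Longrightarrow> AE \<omega> in M. \<Phi> V \<omega> = \<theta> \<omega> (V \<omega>)"
proof -
  have space_G: "space G = space M" using G by (simp add: subalgebra_def)
  obtain D :: "'b set" where D: "countable D" "\<And>X. open X \<Longrightarrow> X \<noteq> {} \<Longrightarrow> \<exists>d\<in>D. d \<in> X"
    using countable_dense_setE by blast
  have "D \<noteq> {}" using D(2)[of UNIV] by auto
  define q where "q = from_nat_into D"
  define B where "B i j = ball (q i) (1 / real (Suc j))" for i j :: nat
  define L where "L i j = {V \<in> borel_measurable G. \<forall>\<omega>. V \<omega> \<in> B i j}" for i j
  have q_in_B: "q i \<in> B i j" for i j by (simp add: B_def)
  have cover: "\<exists>i. v \<in> B i j" for v j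
  proof -
    obtain d where "d \<in> D" "d \<in> ball v (1 / real (Suc j))"
      using D(2)[of "ball v (1 / real (Suc j))"] by auto
    moreover obtain i where "q i = d"
      using from_nat_into_surj[OF D(1) \<open>d \<in> D\<close>] by (auto simp: q_def)
    ultimately show ?thesis by (auto simp: B_def dist_commute)
  qed
  have B_meas[measurable]: "B i j \<in> sets borel" for i j by (simp add: B_def)
  have "\<exists>U. (\<forall>n. U n \<in> L i j) \<and> is_ess_inf M G (\<Phi> ` L i j) (\<lambda>\<omega>. INF n::nat. \<Phi> (U n) \<omega>)" for i j
  proof -
    have "\<Phi> ` L i j \<subseteq> borel_measurable G" by (auto simp: L_def intro: meas)
    moreover have "(\<lambda>_. q i) \<in> L i j" using q_in_B by (simp add: L_def)
    then have "\<Phi> ` L i j \<noteq> {}" by blast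
    ultimately obtain X :: "nat \<Rightarrow> 'a \<Rightarrow> ereal" where X: "range X \<subseteq> \<Phi> ` L i j"
      "is_ess_inf M G (\<Phi> ` L i j) (\<lambda>\<omega>. INF n. X n \<omega>)"
      by (rule ess_inf_eq_countable_INF[OF G])
    from X(1) have "\<forall>n. \<exists>U\<in>L i j. X n = \<Phi> U" by blast
    then obtain U where "\<And>n. U n \<in> L i j" "\<And>n. X n = \<Phi> (U n)" by metis
    then show ?thesis using X(2) by auto
  qed
  then obtain U where U: "\<And>i j n. U i j n \<in> L i j"
    and inf: "\<And>i j. is_ess_inf M G (\<Phi> ` L i j) (\<lambda>\<omega>. INF n::nat. \<Phi> (U i j n) \<omega>)"
    by metis
  have U_meas[measurable]: "U i j n \<in> borel_measurable G" for i j n using U by (auto simp: L_def)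
  define m where "m i j \<omega> = (INF n::nat. \<Phi> (U i j n) \<omega>)" for i j \<omega>
  have m_meas[measurable]: "m i j \<in> borel_measurable G" for i j
    using inf[of i j] by (simp add: is_ess_inf_def m_def[abs_def])
  define \<theta> where "\<theta> \<omega> v = (SUP p. if v \<in> B (fst p) (snd p) then m (fst p) (snd p) \<omega> else - \<infinity>)" for \<omega> v
  have m_le_\<theta>: "m i j \<omega> \<le> \<theta> \<omega> v" if "v \<in> B i j" for i j \<omega> v
    unfolding \<theta>_def by (rule SUP_upper2[of "(i, j)"]) (use that in auto)
  have \<theta>_meas[measurable]: "(\<lambda>(\<omega>, v). \<theta> \<omega> v) \<in> borel_measurable (G \<Otimes>\<^sub>M borel)"
    unfolding \<theta>_def by measurable
  have normal: "normal_integrand G \<theta>"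
    unfolding normal_integrand_def lsc_def
  proof (intro conjI \<theta>_meas ballI allI impI)
    fix \<omega> v a assume "a < \<theta> \<omega> v"
    then obtain i j where ij: "v \<in> B i j" "a < m i j \<omega>"
      unfolding \<theta>_def less_SUP_iff by (auto split: if_splits)
    have "\<forall>\<^sub>F w in nhds v. w \<in> B i j"
      using ij(1) by (intro eventually_nhds_in_open) (simp_all add: B_def)
    then show "\<forall>\<^sub>F w in nhds v. a < \<theta> \<omega> w"
      by eventually_elim (rule less_le_trans[OF ij(2) m_le_\<theta>])
  qed
  have "AE \<omega> in M. \<Phi> V \<omega> = \<theta> \<omega> (V \<omega>)" if V[measurable]: "V \<in> borel_measurable G" for V
  proof -
    have "AE \<omega> in M. V \<omega> \<in> B i j \<longrightarrow> m i j \<omega> \<le> \<Phi> V \<omega>" for i j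
    proof -
      \<comment> \<open>outside the event the centre of the ball keeps the variable inside the ball\<close>
      define W where "W \<omega> = (if V \<omega> \<in> B i j then V \<omega> else q i)" for \<omega>
      have [measurable]: "W \<in> borel_measurable G" unfolding W_def by measurable
      have "W \<in> L i j" using q_in_B by (simp add: L_def W_def)
      then have "AE \<omega> in M. m i j \<omega> \<le> \<Phi> W \<omega>"
        using inf[of i j] by (simp add: is_ess_inf_def m_def)
      moreover have "AE \<omega> in M. \<omega> \<in> {\<omega>\<in>space G. V \<omega> \<in> B i j} \<longrightarrow> \<Phi> V \<omega> = \<Phi> W \<omega>"
        by (rule local) (simp_all add: W_def)
      ultimately show ?thesis
        by (rule AE_mp[OF AE_conjI]) (simp add: space_G)
    qed
    then have "AE \<omega> in M. \<forall>i j. V \<omega> \<in> B i j \<longrightarrow> m i j \<omega> \<le> \<Phi> V \<omega>"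
      by (simp add: AE_all_countable)
    then have lower: "AE \<omega> in M. \<theta> \<omega> (V \<omega>) \<le> \<Phi> V \<omega>"
      unfolding \<theta>_def by eventually_elim (rule SUP_least, simp)
    have "AE \<omega> in M. \<Phi> V \<omega> \<le> loosen l (\<theta> \<omega> (V \<omega>))" for l
    proof -
      define Y where "Y \<omega> = loosen l (\<theta> \<omega> (V \<omega>))" for \<omega>
      have [measurable]: "Y \<in> borel_measurable G" unfolding Y_def by measurable
      \<comment> \<open>an index codes the centre of a ball that contains \<open>V \<omega>\<close> and a near-minimiser in it\<close>
      define good where "good j n \<omega> \<longleftrightarrow> V \<omega> \<in> B (fst (prod_decode n)) j \<and>
        \<Phi> (U (fst (prod_decode n)) j (snd (prod_decode n))) \<omega> < Y \<omega>" for j n \<omega>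
      have [measurable]: "Measurable.pred G (good j n)" for j n
        unfolding good_def using meas[OF U_meas] by measurable
      define N where "N j \<omega> = (LEAST n. good j n \<omega>)" for j \<omega>
      have N_meas[measurable]: "N j \<in> measurable G (count_space UNIV)" for j
        unfolding N_def by measurable
      define Z where "Z j n = U (fst (prod_decode n)) j (snd (prod_decode n))" for j n
      have Z_meas[measurable]: "Z j n \<in> borel_measurable G" for j n unfolding Z_def by measurable
      have [measurable]: "(\<lambda>\<omega>. Z j (N j \<omega>) \<omega>) \<in> borel_measurable G" for j
        by (rule measurable_compose_countable[OF Z_meas N_meas])
      define W where "W j \<omega> = (if \<exists>n. good j n \<omega> then Z j (N j \<omega>) \<omega> else V \<omega>)" for j \<omega>
      have W_meas[measurable]: "W j \<in> borel_measurable G" for j unfolding W_def by measurable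
      have good_N: "good j (N j \<omega>) \<omega>" if "\<exists>n. good j n \<omega>" for j \<omega>
        unfolding N_def using that by (rule LeastI_ex)
      have ex_good: "\<exists>n. good j n \<omega>" if "Y \<omega> < \<infinity>" for j \<omega>
      proof -
        obtain i where i: "V \<omega> \<in> B i j" using cover by blast
        have "m i j \<omega> < Y \<omega>"
          unfolding Y_def
          by (rule le_less_trans[OF m_le_\<theta>[OF i] loosen_gt])
            (use that in \<open>auto simp: Y_def less_top[symmetric] loosen_eq_infinity_iff\<close>)
        then obtain n where "\<Phi> (U i j n) \<omega> < Y \<omega>" by (auto simp: m_def INF_less_iff)
        then show ?thesis using i by (intro exI[of _ "prod_encode (i, n)"]) (simp add: good_def)
      qed
      have dist_W: "dist (W j \<omega>) (V \<omega>) \<le> 2 / real (Suc j)" for j \<omega>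
      proof (cases "\<exists>n. good j n \<omega>")
        case True
        define i where "i = fst (prod_decode (N j \<omega>))"
        have "V \<omega> \<in> B i j" using good_N[OF True] by (simp add: good_def i_def)
        moreover have "W j \<omega> \<in> B i j" using True U by (simp add: W_def Z_def L_def i_def)
        ultimately show ?thesis
          using dist_triangle2[of "W j \<omega>" "V \<omega>" "q i"] by (simp add: B_def dist_commute)
      qed (simp add: W_def)
      have "(\<lambda>j. W j \<omega>) \<longlonglongrightarrow> V \<omega>" for \<omega>
      proof -
        have "(\<lambda>j. 2 * inverse (real (Suc j))) \<longlonglongrightarrow> 2 * 0"
          by (intro tendsto_mult tendsto_const LIMSEQ_inverse_real_of_nat)
        then have "(\<lambda>j. 2 / real (Suc j)) \<longlonglongrightarrow> 0" by (simp add: divide_inverse)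
        then have "(\<lambda>j. dist (W j \<omega>) (V \<omega>)) \<longlonglongrightarrow> 0"
          by (rule Lim_null_comparison[rotated]) (simp add: dist_W del: of_nat_Suc)
        then show ?thesis by (subst tendsto_dist_iff)
      qed
      moreover have "AE \<omega> in M. \<Phi> (W j) \<omega> \<le> Y \<omega>" for j
      proof -
        have "AE \<omega> in M. \<omega> \<in> {\<omega>\<in>space G. (\<exists>n. good j n \<omega>) \<and> N j \<omega> = n} \<longrightarrow>
            \<Phi> (W j) \<omega> = \<Phi> (Z j n) \<omega>" for n
          by (rule local) (auto simp: W_def)
        then have "AE \<omega> in M. \<forall>n. \<omega> \<in> {\<omega>\<in>space G. (\<exists>n. good j n \<omega>) \<and> N j \<omega> = n} \<longrightarrow>
            \<Phi> (W j) \<omega> = \<Phi> (Z j n) \<omega>" unfolding AE_all_countable by blast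
        with AE_space show ?thesis
        proof eventually_elim
          case (elim \<omega>)
          show ?case
          proof (cases "\<exists>n. good j n \<omega>")
            case True
            then have "\<Phi> (W j) \<omega> = \<Phi> (Z j (N j \<omega>)) \<omega>" using elim by (simp add: space_G)
            then show ?thesis using good_N[OF True] by (auto simp: good_def Z_def intro: less_imp_le)
          next
            case False
            then show ?thesis using ex_good[of \<omega> j] by (cases "Y \<omega>") auto
          qed
        qed
      qed
      ultimately have "AE \<omega> in M. \<Phi> V \<omega> \<le> Y \<omega>"
        by (intro closed[of W V Y]) auto
      then show ?thesis by (simp add: Y_def)
    qed
    then have "AE \<omega> in M. \<forall>l. \<Phi> V \<omega> \<le> loosen l (\<theta> \<omega> (V \<omega>))"
      by (simp add: AE_all_countable)
    with lower show ?thesis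
      by eventually_elim (auto intro: antisym le_of_le_loosen)
  qed
  with normal show thesis by (rule that)
qed

text \<open>
  The graph of a random variable is closed at each outcome, so the value \<open>\<infinity>\<close> off the graph does not
  harm lower semicontinuity.
\<close>

lemma normal_integrand_on_graph:
  fixes X :: "'a \<Rightarrow> 'b::{second_countable_topology, t2_space}"
    and \<theta> :: "'a \<Rightarrow> 'c::second_countable_topology \<Rightarrow> ereal"
  assumes \<theta>: "normal_integrand G \<theta>" and X[measurable]: "X \<in> borel_measurable G"
  shows "normal_integrand G (\<lambda>\<omega> p. if fst p = X \<omega> then \<theta> \<omega> (snd p) else \<infinity>)"
  unfolding normal_integrand_def
proof
  have fst_meas[measurable]: "(fst :: 'b \<times> 'c \<Rightarrow> 'b) \<in> borel_measurable borel"
    and snd_meas[measurable]: "(snd :: 'b \<times> 'c \<Rightarrow> 'c) \<in> borel_measurable borel"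
    by (intro borel_measurable_continuous_onI continuous_intros)+
  have "(\<lambda>(\<omega>, x). \<theta> \<omega> x) \<in> borel_measurable (G \<Otimes>\<^sub>M borel)"
    using \<theta> by (simp add: normal_integrand_def)
  moreover have "(\<lambda>p. (fst p, snd (snd p))) \<in> G \<Otimes>\<^sub>M (borel :: ('b \<times> 'c) measure) \<rightarrow>\<^sub>M G \<Otimes>\<^sub>M borel"
    by measurable
  ultimately have [measurable]: "(\<lambda>p. \<theta> (fst p) (snd (snd p))) \<in>
      borel_measurable (G \<Otimes>\<^sub>M (borel :: ('b \<times> 'c) measure))"
    by (auto dest: measurable_compose[rotated])
  have [measurable]: "Measurable.pred (G \<Otimes>\<^sub>M (borel :: ('b \<times> 'c) measure)) (\<lambda>p. fst (snd p) = X (fst p))"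
    by measurable
  show "(\<lambda>(\<omega>, p). if fst p = X \<omega> then \<theta> \<omega> (snd p) else \<infinity>) \<in> borel_measurable (G \<Otimes>\<^sub>M borel)"
    unfolding case_prod_beta by measurable
  show "\<forall>\<omega>\<in>space G. lsc (\<lambda>p. if fst p = X \<omega> then \<theta> \<omega> (snd p) else \<infinity>)"
    unfolding lsc_def
  proof (intro ballI allI impI)
    fix \<omega> p a assume \<omega>: "\<omega> \<in> space G" and a: "a < (if fst p = X \<omega> then \<theta> \<omega> (snd p) else \<infinity>)"
    have fst_lim: "filterlim fst (nhds (fst p)) (nhds p)"
      and snd_lim: "filterlim snd (nhds (snd p)) (nhds p)"
      by (intro tendsto_intros filterlim_ident)+
    show "\<forall>\<^sub>F x in nhds p. a < (if fst x = X \<omega> then \<theta> \<omega> (snd x) else \<infinity>)"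
    proof (cases "fst p = X \<omega>")
      case True
      then have "\<forall>\<^sub>F y in nhds (snd p). a < \<theta> \<omega> y"
        using a \<theta> \<omega> by (auto simp: normal_integrand_def lsc_def)
      then have "\<forall>\<^sub>F x in nhds p. a < \<theta> \<omega> (snd x)"
        using snd_lim by (rule eventually_compose_filterlim)
      then show ?thesis by eventually_elim (use le_less_trans in auto)
    next
      case False
      then have "\<forall>\<^sub>F s in nhds (fst p). s \<in> - {X \<omega>}"
        by (intro eventually_nhds_in_open) auto
      then have "\<forall>\<^sub>F x in nhds p. fst x \<in> - {X \<omega>}"
        using fst_lim by (rule eventually_compose_filterlim)
      then show ?thesis using a False by (auto elim: eventually_mono)
    qed
  qed
qed

text \<open>
  This is lower semicontinuity of \<open>f + g\<close> along sequences. The real function is kept on the right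
  because there it is the cost of a trade, subtracted from what is available for the continuation.
\<close>

lemma lsc_sum_le_of_limit:
  fixes f :: "'b::topological_space \<Rightarrow> real" and g :: "'c::topological_space \<Rightarrow> ereal"
  assumes f: "lsc f" "x \<longlonglongrightarrow> x0" and g: "lsc g" "y \<longlonglongrightarrow> y0"
    and le: "\<And>j. g (y j) \<le> ereal q - ereal (f (x j))"
  shows "g y0 \<le> ereal q - ereal (f x0)"
proof (rule ccontr)
  assume "\<not> ?thesis"
  then have "ereal (q - f x0) < g y0" by simp
  then obtain b where b: "q - f x0 < b" "ereal b < g y0"
    using ereal_dense2[of "ereal (q - f x0)" "g y0"] by auto
  have "\<forall>\<^sub>F z in nhds x0. q - b < f z"
    using f(1) b(1) unfolding lsc_def by auto
  then have "\<forall>\<^sub>F j in sequentially. q - b < f (x j)"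
    using f(2) by (rule eventually_compose_filterlim)
  moreover have "\<forall>\<^sub>F z in nhds y0. ereal b < g z"
    using g(1) b(2) unfolding lsc_def by auto
  then have "\<forall>\<^sub>F j in sequentially. ereal b < g (y j)"
    using g(2) by (rule eventually_compose_filterlim)
  ultimately have "\<forall>\<^sub>F j in sequentially. q - b < f (x j) \<and> ereal b < g (y j)"
    by (rule eventually_conj)
  then obtain j where j: "q - b < f (x j)" "ereal b < g (y j)"
    using eventually_happens'[OF sequentially_bot] by blast
  have "ereal b < ereal (q - f (x j))" using less_le_trans[OF j(2) le] by simp
  then show False using j(1) by simp
qed

section \<open>Strategies and their cost\<close>

lemma noncash_eq: "noncash k z = z - z $ k *\<^sub>R axis k 1"
  by (simp add: noncash_def vec_eq_iff axis_def)

lemma noncash_zero [simp]: "noncash k 0 = 0"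
  by (simp add: noncash_eq)

lemma noncash_scaleR: "noncash k (c *\<^sub>R z) = c *\<^sub>R noncash k z"
  by (simp add: noncash_eq scaleR_diff_right)

lemma noncash_diff: "noncash k (x - y) = noncash k x - noncash k y"
  by (simp add: noncash_eq scaleR_diff_left)

lemma noncash_minus: "noncash k (- z) = - noncash k z"
  by (simp add: noncash_eq)

lemma noncash_noncash [simp]: "noncash k (noncash k z) = noncash k z"
  by (simp add: noncash_eq)

lemma noncash_in_noncash_space: "noncash k z \<in> noncash_space k"
  by (simp add: noncash_def noncash_space_def)

lemma noncash_of_noncash_space: "z \<in> noncash_space k \<Longrightarrow> noncash k z = z"
  by (simp add: noncash_eq noncash_space_def)

lemma continuous_on_noncash: "continuous_on X (noncash k)"
  unfolding noncash_eq[abs_def] by (intro continuous_intros)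

lemma tendsto_noncash: "(f \<longlongrightarrow> l) X \<Longrightarrow> ((\<lambda>x. noncash k (f x)) \<longlongrightarrow> noncash k l) X"
  using continuous_on_noncash[of UNIV k] continuous_on_tendsto_compose[of UNIV "noncash k" f l X]
  by simp

lemma borel_measurable_noncash [measurable]: "noncash k \<in> borel_measurable borel"
  by (rule borel_measurable_continuous_onI[OF continuous_on_noncash])

context cost_market
begin

definition total_cost :: "('a \<Rightarrow> real ^ 'd) \<Rightarrow> nat \<Rightarrow> (int \<Rightarrow> 'a \<Rightarrow> real ^ 'd) \<Rightarrow> 'a \<Rightarrow> real" where
  "total_cost \<xi> t V \<omega> =
     \<xi> \<omega> $ k + (\<Sum>s=t..T. C s (S s \<omega>) (noncash k (V (int s) \<omega> - V (int s - 1) \<omega>)))"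

abbreviation "strats \<equiv> strategies M F T k"
abbreviation "hcost \<equiv> hedging_cost M F T S C k"

lemma space_F: "t \<le> T \<Longrightarrow> space (F t) = space M"
  using subalg by (simp add: subalgebra_def)

lemma measurable_F_mono:
  assumes "u \<le> t" "t \<le> T" "f \<in> measurable (F u) N"
  shows "f \<in> measurable (F t) N"
proof (rule measurable_from_subalg[OF _ assms(3)])
  show "subalgebra (F t) (F u)"
    using filtration_mono[OF assms(1,2)] assms(1,2) by (simp add: subalgebra_def space_F)
qed

lemma borel_measurable_cost:
  assumes "t \<le> T" "z \<in> borel_measurable (F t)"
  shows "(\<lambda>\<omega>. C t (S t \<omega>) (noncash k (z \<omega>))) \<in> borel_measurable (F t)"
proof -
  note [measurable] = S_measurable[OF assms(1)] assms(2)
  have "(\<lambda>\<omega>. (S t \<omega>, noncash k (z \<omega>))) \<in> F t \<rightarrow>\<^sub>M borel"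
    by (intro borel_measurable_Pair) measurable
  from measurable_compose[OF this C_borel[OF assms(1)]] show ?thesis by simp
qed

lemma strategies_nonempty: "t \<le> T \<Longrightarrow> strats \<xi> t v \<noteq> {}"
proof -
  assume "t \<le> T"
  then have "(\<lambda>s \<omega>. if s = int t - 1 then noncash k (v \<omega>) else if s = int T then noncash k (\<xi> \<omega>) else 0)
      \<in> strats \<xi> t v"
    by (auto simp: strategies_def L0_def noncash_space_def)
  then show ?thesis by blast
qed

lemma is_ess_inf_hedging_cost:
  assumes "t \<le> T"
  shows "is_ess_inf M (F t)
    ((\<lambda>V. ess_sup M (F t) {\<lambda>\<omega>. ereal (total_cost \<xi> t V \<omega>)}) ` strats \<xi> t v) (hcost \<xi> t v)"
  unfolding hedging_cost_def total_cost_def[symmetric]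
proof (rule is_ess_inf_ess_inf[OF subalg[OF assms]])
  show "(\<lambda>V. ess_sup M (F t) {\<lambda>\<omega>. ereal (total_cost \<xi> t V \<omega>)}) ` strats \<xi> t v
      \<subseteq> borel_measurable (F t)"
    using is_ess_sup_ess_sup[OF subalg[OF assms]] by (auto simp: is_ess_sup_def)
qed (use strategies_nonempty[OF assms] in blast)

lemma borel_measurable_hedging_cost: "t \<le> T \<Longrightarrow> hcost \<xi> t v \<in> borel_measurable (F t)"
  using is_ess_inf_hedging_cost by (auto simp: is_ess_inf_def)

lemma hedging_cost_le:
  assumes "t \<le> T" "V \<in> strats \<xi> t v" "Y \<in> borel_measurable (F t)"
    and "AE \<omega> in M. ereal (total_cost \<xi> t V \<omega>) \<le> Y \<omega>"
  shows "AE \<omega> in M. hcost \<xi> t v \<omega> \<le> Y \<omega>"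
proof -
  have "AE \<omega> in M. hcost \<xi> t v \<omega> \<le> ess_sup M (F t) {\<lambda>\<omega>. ereal (total_cost \<xi> t V \<omega>)} \<omega>"
    using is_ess_inf_hedging_cost[OF assms(1), of \<xi> v] assms(2) by (auto simp: is_ess_inf_def)
  moreover have "AE \<omega> in M. ess_sup M (F t) {\<lambda>\<omega>. ereal (total_cost \<xi> t V \<omega>)} \<omega> \<le> Y \<omega>"
    using is_ess_sup_ess_sup[OF subalg[OF assms(1)]] assms(3,4) by (auto simp: is_ess_sup_def)
  ultimately show ?thesis by eventually_elim (rule order_trans)
qed

text \<open>
  Together with \<open>hedging_cost_le\<close> this describes the hedging cost by single strategies: a bound that strictly exceeds the hedging cost is met by a single strategy. At each outcome the
  pasted strategy follows the first member of a minimising sequence that meets the bound. The events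
  used for pasting belong to \<open>F t\<close>, so the result stays adapted.
\<close>

lemma ex_strategy_of_hedging_cost_less:
  assumes t: "t \<le> T" and Y: "Y \<in> borel_measurable (F t)"
    and less: "AE \<omega> in M. Y \<omega> < \<infinity> \<longrightarrow> hcost \<xi> t v \<omega> < Y \<omega>"
  obtains V where "V \<in> strats \<xi> t v" "AE \<omega> in M. ereal (total_cost \<xi> t V \<omega>) \<le> Y \<omega>"
proof -
  define E where "E V = ess_sup M (F t) {\<lambda>\<omega>. ereal (total_cost \<xi> t V \<omega>)}" for V
  have E: "is_ess_sup M (F t) {\<lambda>\<omega>. ereal (total_cost \<xi> t V \<omega>)} (E V)" for V
    unfolding E_def by (rule is_ess_sup_ess_sup[OF subalg[OF t]])
  have "E ` strats \<xi> t v \<subseteq> borel_measurable (F t)" using E by (auto simp: is_ess_sup_def)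
  moreover have "E ` strats \<xi> t v \<noteq> {}" using strategies_nonempty[OF t] by blast
  ultimately obtain X :: "nat \<Rightarrow> 'a \<Rightarrow> ereal" where X: "range X \<subseteq> E ` strats \<xi> t v"
    "is_ess_inf M (F t) (E ` strats \<xi> t v) (\<lambda>\<omega>. INF n. X n \<omega>)"
    by (rule ess_inf_eq_countable_INF[OF subalg[OF t]])
  from X(1) have "\<forall>n. \<exists>W\<in>strats \<xi> t v. X n = E W" by blast
  then obtain W where W: "\<And>n. W n \<in> strats \<xi> t v" and X_eq: "\<And>n. X n = E (W n)" by metis
  have [measurable]: "X n \<in> borel_measurable (F t)" for n
    using E by (simp add: X_eq is_ess_sup_def)
  note [measurable] = Y
  have inf_le: "AE \<omega> in M. (INF n. X n \<omega>) \<le> hcost \<xi> t v \<omega>"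
    using is_ess_inf_hedging_cost[OF t, of \<xi> v] X(2)
    unfolding E_def[symmetric] by (auto simp: is_ess_inf_def)
  define N where "N \<omega> = (LEAST n. X n \<omega> < Y \<omega>)" for \<omega>
  have N: "N \<in> measurable (F t) (count_space UNIV)" unfolding N_def by measurable
  define V where "V s \<omega> = W (N \<omega>) s \<omega>" for s \<omega>
  have "V \<in> strats \<xi> t v"
    unfolding strategies_def
  proof (intro CollectI conjI ballI)
    show "V (int t - 1) = (\<lambda>\<omega>. noncash k (v \<omega>))" "V (int T) = (\<lambda>\<omega>. noncash k (\<xi> \<omega>))"
      using W by (auto simp: V_def strategies_def)
    fix s assume s: "s \<in> {t..<T}"
    have Ws: "W n (int s) \<in> L0 M (F s) (noncash_space k)" for n
      using W[of n] s by (simp add: strategies_def)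
    have "V (int s) \<in> borel_measurable (F s)"
      unfolding V_def
      by (rule measurable_compose_countable[OF _ measurable_F_mono[OF _ _ N]])
        (use Ws s in \<open>auto simp: L0_def\<close>)
    moreover have "AE \<omega> in M. \<forall>n. W n (int s) \<omega> \<in> noncash_space k"
      using Ws by (simp add: L0_def AE_all_countable)
    then have "AE \<omega> in M. V (int s) \<omega> \<in> noncash_space k"
      by eventually_elim (simp add: V_def)
    ultimately show "V (int s) \<in> L0 M (F s) (noncash_space k)" by (simp add: L0_def)
  qed
  moreover have "AE \<omega> in M. \<forall>n. ereal (total_cost \<xi> t (W n) \<omega>) \<le> X n \<omega>"
    using E by (simp add: AE_all_countable X_eq is_ess_sup_def)
  with inf_le less have "AE \<omega> in M. ereal (total_cost \<xi> t V \<omega>) \<le> Y \<omega>"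
  proof eventually_elim
    case (elim \<omega>)
    show ?case
    proof (cases "Y \<omega> < \<infinity>")
      case True
      then have "(INF n. X n \<omega>) < Y \<omega>" using elim by (auto intro: le_less_trans)
      then have "\<exists>n. X n \<omega> < Y \<omega>" by (auto simp: INF_less_iff)
      then have "X (N \<omega>) \<omega> < Y \<omega>" unfolding N_def by (rule LeastI_ex)
      moreover have "total_cost \<xi> t V \<omega> = total_cost \<xi> t (W (N \<omega>)) \<omega>"
        by (simp add: total_cost_def V_def)
      ultimately show ?thesis using elim(3) by (metis order_trans less_imp_le)
    qed simp
  qed
  ultimately show thesis by (rule that)
qed

lemma total_cost_cong:
  assumes "\<And>r. int t - 1 \<le> r \<Longrightarrow> r \<le> int T \<Longrightarrow> V r \<omega> = W r \<omega>"
  shows "total_cost \<xi> t V \<omega> = total_cost \<xi> t W \<omega>"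
  unfolding total_cost_def using assms by (intro arg_cong2[where f = "(+)"] sum.cong) auto

text \<open>
  On the event, any strategy starting from \<open>v\<close> can be followed from \<open>w\<close> at the same cost; off the
  event the zero position is adapted, and the bound \<open>\<infinity>\<close> asks nothing of it.
\<close>

lemma hedging_cost_local_le:
  assumes t: "t \<le> T" and A: "A \<in> sets (F t)" and eq: "\<And>\<omega>. \<omega> \<in> A \<Longrightarrow> v \<omega> = w \<omega>"
  shows "AE \<omega> in M. \<omega> \<in> A \<longrightarrow> hcost \<xi> t w \<omega> \<le> hcost \<xi> t v \<omega>"
proof -
  define E where "E V = ess_sup M (F t) {\<lambda>\<omega>. ereal (total_cost \<xi> t V \<omega>)}" for V
  have E: "is_ess_sup M (F t) {\<lambda>\<omega>. ereal (total_cost \<xi> t V \<omega>)} (E V)" for V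
    unfolding E_def by (rule is_ess_sup_ess_sup[OF subalg[OF t]])
  note [measurable] = borel_measurable_hedging_cost[OF t] A
  have "AE \<omega> in M. (if \<omega> \<in> A then hcost \<xi> t w \<omega> else - \<infinity>) \<le> E V \<omega>"
    if V: "V \<in> strats \<xi> t v" for V
  proof -
    define W where "W s \<omega> = (if s = int t - 1 then noncash k (w \<omega>)
      else if s = int T then noncash k (\<xi> \<omega>) else if \<omega> \<in> A then V s \<omega> else 0)" for s \<omega>
    have "W \<in> strats \<xi> t w"
      unfolding strategies_def
    proof (intro CollectI conjI ballI)
      show "W (int t - 1) = (\<lambda>\<omega>. noncash k (w \<omega>))" "W (int T) = (\<lambda>\<omega>. noncash k (\<xi> \<omega>))"
        using t by (auto simp: W_def)
      fix s assume s: "s \<in> {t..<T}"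
      have W_eq: "W (int s) = (\<lambda>\<omega>. if \<omega> \<in> A then V (int s) \<omega> else 0)"
        using s by (auto simp: W_def)
      have "A \<in> sets (F s)" using A filtration_mono[of t s] s by auto
      moreover have "V (int s) \<in> L0 M (F s) (noncash_space k)"
        using V s by (simp add: strategies_def)
      ultimately show "W (int s) \<in> L0 M (F s) (noncash_space k)"
        unfolding W_eq L0_def by (auto intro!: measurable_If_set simp: noncash_space_def)
    qed
    moreover have Y: "(\<lambda>\<omega>. if \<omega> \<in> A then E V \<omega> else \<infinity>) \<in> borel_measurable (F t)"
      using E[of V] by (auto intro!: measurable_If_set simp: is_ess_sup_def)
    moreover have "AE \<omega> in M. ereal (total_cost \<xi> t V \<omega>) \<le> E V \<omega>"
      using E[of V] by (simp add: is_ess_sup_def)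
    then have "AE \<omega> in M. ereal (total_cost \<xi> t W \<omega>) \<le> (if \<omega> \<in> A then E V \<omega> else \<infinity>)"
    proof eventually_elim
      case (elim \<omega>)
      have "total_cost \<xi> t W \<omega> = total_cost \<xi> t V \<omega>" if "\<omega> \<in> A"
        by (rule total_cost_cong) (use V eq[OF that] that in \<open>auto simp: W_def strategies_def\<close>)
      then show ?case using elim by auto
    qed
    ultimately have "AE \<omega> in M. hcost \<xi> t w \<omega> \<le> (if \<omega> \<in> A then E V \<omega> else \<infinity>)"
      by (rule hedging_cost_le[OF t])
    then show ?thesis by eventually_elim auto
  qed
  then have "AE \<omega> in M. (if \<omega> \<in> A then hcost \<xi> t w \<omega> else - \<infinity>) \<le> hcost \<xi> t v \<omega>"
    using is_ess_inf_hedging_cost[OF t, of \<xi> v] unfolding E_def[symmetric]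
    by (auto simp: is_ess_inf_def elim!: ballE[where x = "\<lambda>\<omega>. if \<omega> \<in> A then hcost \<xi> t w \<omega> else - \<infinity>"])
  then show ?thesis by eventually_elim auto
qed

lemma hedging_cost_local:
  assumes "t \<le> T" "A \<in> sets (F t)" "\<And>\<omega>. \<omega> \<in> A \<Longrightarrow> v \<omega> = w \<omega>"
  shows "AE \<omega> in M. \<omega> \<in> A \<longrightarrow> hcost \<xi> t v \<omega> = hcost \<xi> t w \<omega>"
  using hedging_cost_local_le[OF assms] hedging_cost_local_le[OF assms(1,2), of w v]
  by (rule AE_mp[OF AE_conjI]) (use assms(3) in \<open>auto intro: antisym\<close>)

lemma total_cost_Suc:
  assumes "t < T"
  shows "total_cost \<xi> t V \<omega> =
    C t (S t \<omega>) (noncash k (V (int t) \<omega> - V (int t - 1) \<omega>)) + total_cost \<xi> (Suc t) V \<omega>"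
  using assms by (simp add: total_cost_def sum.atLeast_Suc_atMost)

text \<open>
  The position at time \<open>t\<close> becomes the initial entry of the tail, which by definition has to vanish in
  the cash coordinate everywhere, while positions of a strategy do so only almost surely; hence the
  update.
\<close>

lemma strategy_tail:
  assumes t: "t < T" and V: "V \<in> strats \<xi> t v"
  defines "V' \<equiv> V(int t := (\<lambda>\<omega>. noncash k (V (int t) \<omega>)))"
  shows "V' \<in> strats \<xi> (Suc t) (V (int t))"
    and "total_cost \<xi> (Suc t) V' \<omega> = total_cost \<xi> (Suc t) V \<omega>"
proof -
  show "V' \<in> strats \<xi> (Suc t) (V (int t))"
    using assms by (auto simp: strategies_def)
  show "total_cost \<xi> (Suc t) V' \<omega> = total_cost \<xi> (Suc t) V \<omega>"
    unfolding total_cost_def V'_def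
    by (intro arg_cong2[where f = "(+)"] sum.cong refl) (auto simp: noncash_diff)
qed

lemma strategy_cons:
  fixes v :: "'a \<Rightarrow> real ^ 'd"
  assumes t: "t < T" and w: "w \<in> borel_measurable (F t)" and U: "U \<in> strats \<xi> (Suc t) w"
  defines "U' \<equiv> U(int t - 1 := (\<lambda>\<omega>. noncash k (v \<omega>)))"
  shows "U' \<in> strats \<xi> t v"
    and "total_cost \<xi> t U' \<omega> =
      C t (S t \<omega>) (noncash k (w \<omega> - v \<omega>)) + total_cost \<xi> (Suc t) U \<omega>"
proof -
  have Ut: "U (int t) = (\<lambda>\<omega>. noncash k (w \<omega>))" using U by (simp add: strategies_def)
  have "U (int s) \<in> L0 M (F s) (noncash_space k)" if "s \<in> {t..<T}" for s
  proof (cases "s = t")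
    case True
    then show ?thesis using w by (simp add: Ut L0_def noncash_in_noncash_space)
  next
    case False
    then show ?thesis using U that by (simp add: strategies_def)
  qed
  then show "U' \<in> strats \<xi> t v"
    using assms by (auto simp: strategies_def)
  have "total_cost \<xi> (Suc t) U' \<omega> = total_cost \<xi> (Suc t) U \<omega>"
    by (rule total_cost_cong) (simp add: U'_def)
  then show "total_cost \<xi> t U' \<omega> =
      C t (S t \<omega>) (noncash k (w \<omega> - v \<omega>)) + total_cost \<xi> (Suc t) U \<omega>"
    unfolding total_cost_Suc[OF t] by (simp add: U'_def Ut noncash_diff)
qed

text \<open>
  The first half of dynamic programming: after paying for the trade at time \<open>t\<close>, the rest of the bound
  is \<open>F t\<close>-measurable, hence an admissible bound one step later.
\<close>

lemma hedging_cost_Suc_le: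
  assumes t: "t < T" and v: "v \<in> borel_measurable (F t)" and V: "V \<in> strats \<xi> t v"
    and Y: "Y \<in> borel_measurable (F t)"
    and le: "AE \<omega> in M. ereal (total_cost \<xi> t V \<omega>) \<le> Y \<omega>"
  shows "AE \<omega> in M. hcost \<xi> (Suc t) (V (int t)) \<omega> \<le>
    Y \<omega> - ereal (C t (S t \<omega>) (noncash k (V (int t) \<omega> - v \<omega>)))"
proof -
  have w: "V (int t) \<in> borel_measurable (F t)" using V t by (simp add: strategies_def L0_def)
  have [measurable]: "(\<lambda>\<omega>. C t (S t \<omega>) (noncash k (V (int t) \<omega> - v \<omega>))) \<in> borel_measurable (F t)"
    using t by (intro borel_measurable_cost borel_measurable_diff w v) simp
  note [measurable] = Y
  have "(\<lambda>\<omega>. Y \<omega> - ereal (C t (S t \<omega>) (noncash k (V (int t) \<omega> - v \<omega>)))) \<in> borel_measurable (F t)"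
    by measurable
  then have "(\<lambda>\<omega>. Y \<omega> - ereal (C t (S t \<omega>) (noncash k (V (int t) \<omega> - v \<omega>))))
      \<in> borel_measurable (F (Suc t))"
    using t by (auto intro: measurable_F_mono[of t])
  moreover have "AE \<omega> in M. ereal (total_cost \<xi> (Suc t) (V(int t := (\<lambda>\<omega>. noncash k (V (int t) \<omega>)))) \<omega>)
      \<le> Y \<omega> - ereal (C t (S t \<omega>) (noncash k (V (int t) \<omega> - v \<omega>)))"
    using le
  proof eventually_elim
    case (elim \<omega>)
    have "V (int t - 1) \<omega> = noncash k (v \<omega>)" using V by (simp add: strategies_def)
    then show ?case
      using elim unfolding strategy_tail(2)[OF t V] total_cost_Suc[OF t]
      by (cases "Y \<omega>") (auto simp: noncash_diff)
  qed
  ultimately show ?thesis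
    using t by (intro hedging_cost_le[OF _ strategy_tail(1)[OF t V]]) auto
qed

text \<open>
  The second half of dynamic programming: a continuation that meets the remaining bound is
  preceded by the position \<open>w\<close>.
\<close>

lemma hedging_cost_le_of_Suc:
  assumes t: "t < T" and v: "v \<in> borel_measurable (F t)" and w: "w \<in> borel_measurable (F t)"
    and Y: "Y \<in> borel_measurable (F t)"
    and less: "AE \<omega> in M. Y \<omega> < \<infinity> \<longrightarrow>
      hcost \<xi> (Suc t) w \<omega> < Y \<omega> - ereal (C t (S t \<omega>) (noncash k (w \<omega> - v \<omega>)))"
  shows "AE \<omega> in M. hcost \<xi> t v \<omega> \<le> Y \<omega>"
proof -
  have [measurable]: "(\<lambda>\<omega>. C t (S t \<omega>) (noncash k (w \<omega> - v \<omega>))) \<in> borel_measurable (F t)"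
    using t by (intro borel_measurable_cost borel_measurable_diff w v) simp
  note [measurable] = Y
  define Z where "Z \<omega> = Y \<omega> - ereal (C t (S t \<omega>) (noncash k (w \<omega> - v \<omega>)))" for \<omega>
  have "Z \<in> borel_measurable (F t)" unfolding Z_def by measurable
  then have Z: "Z \<in> borel_measurable (F (Suc t))" using t by (auto intro: measurable_F_mono[of t])
  have less_Z: "AE \<omega> in M. Z \<omega> < \<infinity> \<longrightarrow> hcost \<xi> (Suc t) w \<omega> < Z \<omega>"
    using less
  proof eventually_elim
    case (elim \<omega>)
    then show ?case by (cases "Y \<omega>") (simp_all add: Z_def)
  qed
  have "Suc t \<le> T" using t by simp
  then obtain U where U: "U \<in> strats \<xi> (Suc t) w" "AE \<omega> in M. ereal (total_cost \<xi> (Suc t) U \<omega>) \<le> Z \<omega>"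
    using Z less_Z by (rule ex_strategy_of_hedging_cost_less)
  from U(2) have "AE \<omega> in M. ereal (total_cost \<xi> t (U(int t - 1 := (\<lambda>\<omega>. noncash k (v \<omega>)))) \<omega>) \<le> Y \<omega>"
  proof eventually_elim
    case (elim \<omega>)
    then show ?case
      unfolding strategy_cons(2)[OF t w U(1)] by (cases "Y \<omega>") (auto simp: Z_def)
  qed
  with t show ?thesis
    by (intro hedging_cost_le[OF _ strategy_cons(1)[OF t w U(1)] Y]) auto
qed

end

section \<open>Coercivity\<close>

text \<open>
  An increasing bijection of \<open>[0, \<infinity>]\<close> that fixes the endpoints is finite and positive at positive
  reals, and unbounded there because it is onto; so the rate may be taken real-valued.
\<close>

lemma super_homogeneous_real_rate:
  assumes "super_homogeneous T C \<delta>"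
  obtains d :: "real \<Rightarrow> real"
  where "mono d" "\<And>r. 1 \<le> r \<Longrightarrow> 0 < d r" "filterlim d at_top at_top"
    "\<And>t r s x. t \<le> T \<Longrightarrow> 1 \<le> r \<Longrightarrow> 0 \<le> s \<Longrightarrow> d r * C t s x \<le> C t s (r *\<^sub>R x)"
proof -
  have \<delta>: "mono \<delta>" "inj \<delta>" "surj \<delta>" "\<delta> 0 = 0" "\<delta> \<infinity> = \<infinity>"
    and hom: "\<And>t l s x. t \<le> T \<Longrightarrow> 1 \<le> l \<Longrightarrow> 0 \<le> s \<Longrightarrow>
      enn2ereal (\<delta> (ennreal l)) * ereal (C t s x) \<le> ereal (C t s (l *\<^sub>R x))"
    using assms by (auto simp: super_homogeneous_def bij_def)
  define d where "d r = enn2real (\<delta> (ennreal r))" for r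
  have fin: "\<delta> (ennreal r) < \<infinity>" for r
    using injD[OF \<delta>(2), of "ennreal r" \<infinity>] \<delta>(5) by (auto simp: top.not_eq_extremum[symmetric])
  have \<delta>_eq: "\<delta> (ennreal r) = ennreal (d r)" for r
    unfolding d_def using fin[of r] by simp
  have d0: "0 \<le> d r" for r by (simp add: d_def)
  have "mono d"
  proof (rule monoI)
    fix x y :: real assume "x \<le> y"
    then have "ennreal (d x) \<le> ennreal (d y)"
      unfolding \<delta>_eq[symmetric] by (intro monoD[OF \<delta>(1)] ennreal_leI)
    then show "d x \<le> d y" using d0 by simp
  qed
  moreover have "0 < d r" if "1 \<le> r" for r
  proof -
    have "\<delta> (ennreal r) \<noteq> \<delta> 0" using that by (subst inj_eq[OF \<delta>(2)]) simp
    then have "d r \<noteq> 0" using \<delta>_eq[of r] \<delta>(4) by auto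
    then show ?thesis using d0[of r] by simp
  qed
  moreover have "filterlim d at_top at_top"
    unfolding filterlim_at_top
  proof
    fix K :: real
    obtain x where x: "\<delta> x = ennreal K" using \<delta>(3) by (metis surjD)
    then have "x \<noteq> \<infinity>" using \<delta>(5) by auto
    then obtain r0 where r0: "x = ennreal r0" by (cases x) auto
    show "\<forall>\<^sub>F r in at_top. K \<le> d r"
      using eventually_ge_at_top[of r0]
    proof eventually_elim
      case (elim r)
      have "ennreal K \<le> ennreal (d r)"
        unfolding x[symmetric] r0 \<delta>_eq[symmetric] by (intro monoD[OF \<delta>(1)] ennreal_leI elim)
      then show ?case using d0[of r] by (cases "0 \<le> K") auto
    qed
  qed
  moreover have "d r * C t s x \<le> C t s (r *\<^sub>R x)" if "t \<le> T" "1 \<le> r" "0 \<le> s" for t r s x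
    using hom[OF that, of x] by (simp add: \<delta>_eq enn2ereal_ennreal[OF d0])
  ultimately show thesis by (rule that)
qed

context cost_market
begin

text \<open>
  The two costs differ in the last trade only. There cash invariance absorbs the cash part of \<open>\<xi>\<close> into
  the cost, and monotonicity of the terminal cost compares what is left.
\<close>

lemma zero_payoff_strategy:
  assumes t: "t \<le> T" and V: "V \<in> strats \<xi> t v"
  defines "V' \<equiv> V(int T := (\<lambda>_. 0))"
  shows "V' \<in> strats (\<lambda>_. 0) t v"
    and "0 \<le> \<xi> \<omega> \<Longrightarrow> total_cost (\<lambda>_. 0) t V' \<omega> \<le> total_cost \<xi> t V \<omega>"
proof -
  show "V' \<in> strats (\<lambda>_. 0) t v" using assms by (auto simp: strategies_def)
  assume \<xi>: "0 \<le> \<xi> \<omega>"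
  define c where "c V s = C s (S s \<omega>) (noncash k (V (int s) \<omega> - V (int s - 1) \<omega>))" for V s
  have eq: "total_cost \<zeta> t V \<omega> = \<zeta> \<omega> $ k + ((\<Sum>s\<in>{t..<T}. c V s) + c V T)" for \<zeta> V
    using t unfolding total_cost_def c_def[symmetric]
    by (simp add: sum.last_plus add.commute)
  have "(\<Sum>s\<in>{t..<T}. c V' s) = (\<Sum>s\<in>{t..<T}. c V s)"
    by (intro sum.cong) (auto simp: c_def V'_def)
  moreover have "c V' T \<le> \<xi> \<omega> $ k + c V T"
  proof -
    let ?y = "V (int T - 1) \<omega>"
    have "V (int T) \<omega> = noncash k (\<xi> \<omega>)" using V by (simp add: strategies_def)
    then have "noncash k (V (int T) \<omega> - ?y) = (\<xi> \<omega> - noncash k ?y) - \<xi> \<omega> $ k *\<^sub>R axis k 1"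
      by (simp add: noncash_diff) (simp add: noncash_eq)
    then have "\<xi> \<omega> $ k + c V T = C T (S T \<omega>) (\<xi> \<omega> - noncash k ?y)"
      using C_cash[of T "S T \<omega>" "\<xi> \<omega> - noncash k ?y" "- \<xi> \<omega> $ k"] by (simp add: c_def)
    moreover have "c V' T = C T (S T \<omega>) (- noncash k ?y)"
      by (simp add: c_def V'_def noncash_minus)
    moreover have "C T (S T \<omega>) (- noncash k ?y) \<le> C T (S T \<omega>) (\<xi> \<omega> - noncash k ?y)"
      by (rule C_mono) (simp add: \<xi>)
    ultimately show ?thesis by simp
  qed
  ultimately show "total_cost (\<lambda>_. 0) t V' \<omega> \<le> total_cost \<xi> t V \<omega>"
    by (simp add: eq)
qed

text \<open>
  The scale is known at time \<open>t\<close>, so the scaled positions stay adapted, and super-homogeneity bounds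
  the cost of each scaled trade by the cost of the original one divided by \<open>d\<close> of the scale.
\<close>

lemma scaled_strategy:
  fixes l :: "'a \<Rightarrow> real"
  assumes t: "t \<le> T" and V: "V \<in> strats (\<lambda>_. 0) t v"
    and l: "l \<in> borel_measurable (F t)" "\<And>\<omega>. 1 \<le> l \<omega>"
    and d: "\<And>t r s x. t \<le> T \<Longrightarrow> 1 \<le> r \<Longrightarrow> 0 \<le> s \<Longrightarrow> d r * C t s x \<le> C t s (r *\<^sub>R x)"
  defines "V' \<equiv> (\<lambda>s \<omega>. V s \<omega> /\<^sub>R l \<omega>)"
  shows "V' \<in> strats (\<lambda>_. 0) t (\<lambda>\<omega>. v \<omega> /\<^sub>R l \<omega>)"
    and "\<omega> \<in> space M \<Longrightarrow> d (l \<omega>) * total_cost (\<lambda>_. 0) t V' \<omega> \<le> total_cost (\<lambda>_. 0) t V \<omega>"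
proof -
  show "V' \<in> strats (\<lambda>_. 0) t (\<lambda>\<omega>. v \<omega> /\<^sub>R l \<omega>)"
    unfolding strategies_def
  proof (intro CollectI conjI ballI)
    fix s assume s: "s \<in> {t..<T}"
    then have Vs: "V (int s) \<in> L0 M (F s) (noncash_space k)" using V by (simp add: strategies_def)
    then have [measurable]: "V (int s) \<in> borel_measurable (F s)" by (simp add: L0_def)
    have [measurable]: "l \<in> borel_measurable (F s)"
      using s by (intro measurable_F_mono[OF _ _ l(1)]) auto
    have "V' (int s) \<in> borel_measurable (F s)" unfolding V'_def by measurable
    moreover have "AE \<omega> in M. V' (int s) \<omega> \<in> noncash_space k"
      using Vs by (auto simp: L0_def V'_def noncash_space_def)
    ultimately show "V' (int s) \<in> L0 M (F s) (noncash_space k)" by (simp add: L0_def)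
  qed (use V in \<open>auto simp: V'_def strategies_def noncash_scaleR\<close>)
  assume \<omega>: "\<omega> \<in> space M"
  have "d (l \<omega>) * C s (S s \<omega>) (noncash k (V' (int s) \<omega> - V' (int s - 1) \<omega>)) \<le>
      C s (S s \<omega>) (noncash k (V (int s) \<omega> - V (int s - 1) \<omega>))" if "s \<le> T" for s
  proof -
    have "l \<omega> *\<^sub>R noncash k (V' (int s) \<omega> - V' (int s - 1) \<omega>) =
        noncash k (V (int s) \<omega> - V (int s - 1) \<omega>)"
      using l(2)[of \<omega>] by (simp add: V'_def noncash_diff noncash_scaleR scaleR_diff_right)
    then show ?thesis
      using d[OF that l(2) S_nonneg[OF that \<omega>], of \<omega> "noncash k (V' (int s) \<omega> - V' (int s - 1) \<omega>)"]
      by simp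
  qed
  then show "d (l \<omega>) * total_cost (\<lambda>_. 0) t V' \<omega> \<le> total_cost (\<lambda>_. 0) t V \<omega>"
    unfolding total_cost_def by (auto simp: sum_distrib_left intro!: sum_mono)
qed

lemma cost_decrement_le:
  assumes "(\<forall>s\<ge>0. \<forall>x y. C t s (x + y) \<ge> C t s x + C t s y) \<or>
           (\<forall>s\<ge>0. \<forall>x y. C t s (x + y) \<le> C t s x + C t s y)"
    and "0 \<le> s"
  shows "C t s x - C t s (x - y) \<le> \<bar>C t s y\<bar> + \<bar>C t s (- y)\<bar>"
  using assms(1)
proof
  assume "\<forall>s\<ge>0. \<forall>x y. C t s (x + y) \<ge> C t s x + C t s y"
  then have "C t s x + C t s (- y) \<le> C t s (x + - y)" using assms(2) by blast
  then show ?thesis by simp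
next
  assume "\<forall>s\<ge>0. \<forall>x y. C t s (x + y) \<le> C t s x + C t s y"
  then have "C t s ((x - y) + y) \<le> C t s (x - y) + C t s y" using assms(2) by blast
  then show ?thesis by simp
qed

text \<open>
  Only the part of the strategy after time \<open>t\<close> is scaled, after its payoff has been replaced by zero.
  Scaling the trade at time \<open>t\<close> as well would also scale \<open>v\<close>; instead this trade is compared with the
  trade from the zero position by additivity. The random scale \<open>max 1 \<bar>w\<bar>\<close> makes the estimate on the
  positivity of \<open>D\<^sup>0\<close> applicable wherever \<open>\<bar>w\<bar> \<ge> 1\<close>, since there the scaled position lies on the sphere.
\<close>

lemma strategy_position_bound:
  assumes t: "t < T"
    and d: "mono d" "\<And>r. 1 \<le> r \<Longrightarrow> 0 < d r"
      "\<And>t r s x. t \<le> T \<Longrightarrow> 1 \<le> r \<Longrightarrow> 0 \<le> s \<Longrightarrow> d r * C t s x \<le> C t s (r *\<^sub>R x)"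
    and \<xi>: "AE \<omega> in M. 0 \<le> \<xi> \<omega>"
    and additive: "(\<forall>s\<ge>0. \<forall>x y. C t s (x + y) \<ge> C t s x + C t s y) \<or>
                   (\<forall>s\<ge>0. \<forall>x y. C t s (x + y) \<le> C t s x + C t s y)"
    and \<theta>: "theta_version M F T S C k (\<lambda>_. 0) t \<theta>"
    and v: "v \<in> borel_measurable (F t)" and V: "V \<in> strats \<xi> t v"
    and Q: "Q \<in> borel_measurable (F t)" "AE \<omega> in M. ereal (total_cost \<xi> t V \<omega>) \<le> Q \<omega>"
  shows "AE \<omega> in M. \<forall>q. Q \<omega> = ereal q \<longrightarrow> 1 \<le> norm (V (int t) \<omega>) \<longrightarrow>
    (INF z\<in>noncash_sphere k. D_pointwise C k t \<theta> \<omega> (S t \<omega>) 0 z) \<le>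
    ereal ((q + \<bar>C t (S t \<omega>) (noncash k (v \<omega>))\<bar> + \<bar>C t (S t \<omega>) (noncash k (- v \<omega>))\<bar>)
      / d (norm (V (int t) \<omega>)))"
proof -
  have tT: "t \<le> T" "Suc t \<le> T" using t by auto
  define w where "w = V (int t)"
  define l where "l \<omega> = max 1 (norm (w \<omega>))" for \<omega>
  define c where "c \<omega> = C t (S t \<omega>) (noncash k (w \<omega> - v \<omega>))" for \<omega>
  define Z where "Z \<omega> = (Q \<omega> - ereal (c \<omega>)) * ereal (1 / d (l \<omega>))" for \<omega>
  have w_noncash: "AE \<omega> in M. w \<omega> \<in> noncash_space k"
    and w[measurable]: "w \<in> borel_measurable (F t)"
    using V t by (auto simp: w_def strategies_def L0_def)
  have l[measurable]: "l \<in> borel_measurable (F t)" unfolding l_def by measurable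
  have l1: "1 \<le> l \<omega>" for \<omega> by (simp add: l_def)
  note dl_pos = d(2)[OF l1]
  note [measurable] = v Q(1) borel_measurable_mono[OF d(1)]
  have [measurable]: "c \<in> borel_measurable (F t)"
    unfolding c_def by (intro borel_measurable_cost tT) measurable
  have Z[measurable]: "Z \<in> borel_measurable (F t)" unfolding Z_def by measurable
  have w_l: "(\<lambda>\<omega>. w \<omega> /\<^sub>R l \<omega>) \<in> borel_measurable (F t)" by measurable

  define V0 where "V0 = V(int T := (\<lambda>_. 0))"
  have V0: "V0 \<in> strats (\<lambda>_. 0) t v"
    unfolding V0_def by (rule zero_payoff_strategy(1)[OF tT(1) V])
  have V0_t: "V0 (int t) = w" using t by (simp add: V0_def w_def)
  define V1 where "V1 = V0(int t := (\<lambda>\<omega>. noncash k (V0 (int t) \<omega>)))"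
  have V1: "V1 \<in> strats (\<lambda>_. 0) (Suc t) w"
    unfolding V1_def V0_t[symmetric] by (rule strategy_tail(1)[OF t V0])
  have l_Suc: "l \<in> borel_measurable (F (Suc t))"
    by (rule measurable_F_mono[OF _ tT(2) l]) simp
  define V2 where "V2 = (\<lambda>s \<omega>. V1 s \<omega> /\<^sub>R l \<omega>)"
  have V2: "V2 \<in> strats (\<lambda>_. 0) (Suc t) (\<lambda>\<omega>. w \<omega> /\<^sub>R l \<omega>)"
    unfolding V2_def by (rule scaled_strategy(1)[OF tT(2) V1 l_Suc l1 d(3)])
  have "AE \<omega> in M. ereal (total_cost (\<lambda>_. 0) (Suc t) V2 \<omega>) \<le> Z \<omega>"
    using Q(2) \<xi> AE_space
  proof eventually_elim
    case (elim \<omega>)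
    have "V0 (int t - 1) \<omega> = noncash k (v \<omega>)" using V0 by (simp add: strategies_def)
    moreover have "total_cost (\<lambda>_. 0) (Suc t) V1 \<omega> = total_cost (\<lambda>_. 0) (Suc t) V0 \<omega>"
      unfolding V1_def by (rule strategy_tail(2)[OF t V0])
    ultimately have "c \<omega> + total_cost (\<lambda>_. 0) (Suc t) V1 \<omega> = total_cost (\<lambda>_. 0) t V0 \<omega>"
      by (simp add: total_cost_Suc[OF t, of _ V0] V0_t c_def noncash_diff)
    also have "\<dots> \<le> total_cost \<xi> t V \<omega>"
      unfolding V0_def by (rule zero_payoff_strategy(2)[OF tT(1) V elim(2)])
    finally have "ereal (c \<omega> + total_cost (\<lambda>_. 0) (Suc t) V1 \<omega>) \<le> Q \<omega>"
      using elim(1) by (meson ereal_less_eq(3) order_trans)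
    moreover have "d (l \<omega>) * total_cost (\<lambda>_. 0) (Suc t) V2 \<omega> \<le> total_cost (\<lambda>_. 0) (Suc t) V1 \<omega>"
      unfolding V2_def by (rule scaled_strategy(2)[OF tT(2) V1 l_Suc l1 d(3) elim(3)])
    ultimately have *: "ereal (c \<omega> + total_cost (\<lambda>_. 0) (Suc t) V1 \<omega>) \<le> Q \<omega>"
      "d (l \<omega>) * total_cost (\<lambda>_. 0) (Suc t) V2 \<omega> \<le> total_cost (\<lambda>_. 0) (Suc t) V1 \<omega>" by simp_all
    show ?case
    proof (cases "Q \<omega>")
      case (real q)
      with * have "d (l \<omega>) * total_cost (\<lambda>_. 0) (Suc t) V2 \<omega> \<le> q - c \<omega>" by simp
      then have "total_cost (\<lambda>_. 0) (Suc t) V2 \<omega> \<le> (q - c \<omega>) / d (l \<omega>)"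
        using dl_pos[of \<omega>] by (simp add: pos_le_divide_eq mult.commute)
      then show ?thesis by (simp add: Z_def real)
    next
      case PInf
      then show ?thesis using dl_pos[of \<omega>] by (simp add: Z_def)
    next
      case MInf
      then show ?thesis using * by simp
    qed
  qed
  then have "AE \<omega> in M. hcost (\<lambda>_. 0) (Suc t) (\<lambda>\<omega>. w \<omega> /\<^sub>R l \<omega>) \<omega> \<le> Z \<omega>"
    by (rule hedging_cost_le[OF tT(2) V2 measurable_F_mono[OF le_SucI[OF order_refl] tT(2) Z]])
  then have "AE \<omega> in M. theta M F T S C k (\<lambda>_. 0) t (\<lambda>\<omega>. w \<omega> /\<^sub>R l \<omega>) \<omega> \<le> Z \<omega>"
    unfolding theta_def using is_ess_sup_ess_sup[OF subalg[OF tT(1)]] Z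
    by (simp add: is_ess_sup_def)
  moreover have "AE \<omega> in M. theta M F T S C k (\<lambda>_. 0) t (\<lambda>\<omega>. w \<omega> /\<^sub>R l \<omega>) \<omega> = \<theta> \<omega> (w \<omega> /\<^sub>R l \<omega>)"
    using \<theta> w_l by (simp add: theta_version_def L0_def)
  ultimately show ?thesis
    unfolding w_def[symmetric] using w_noncash AE_space
  proof eventually_elim
    case (elim \<omega>)
    show ?case
    proof (intro allI impI)
      fix q assume q: "Q \<omega> = ereal q" and w1: "1 \<le> norm (w \<omega>)"
      then have l_eq: "l \<omega> = norm (w \<omega>)" by (simp add: l_def)
      define z where "z = w \<omega> /\<^sub>R l \<omega>"
      have z: "z \<in> noncash_sphere k"
      proof -
        have "w \<omega> \<noteq> 0" using w1 by auto
        then show ?thesis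
          using elim(3) by (simp add: z_def l_eq noncash_sphere_def noncash_space_def)
      qed
      have w_eq: "noncash k (w \<omega>) = w \<omega>" by (rule noncash_of_noncash_space[OF elim(3)])
      then have z_eq: "noncash k z = z" unfolding z_def noncash_scaleR by (rule arg_cong)
      have S0: "0 \<le> S t \<omega>" using S_nonneg[OF tT(1) elim(4)] .
      have "d (l \<omega>) * C t (S t \<omega>) z \<le> C t (S t \<omega>) (w \<omega>)"
        using d(3)[OF tT(1) l1 S0, of \<omega> z] l1[of \<omega>] by (simp add: z_def)
      then have Cz: "C t (S t \<omega>) z \<le> C t (S t \<omega>) (w \<omega>) / d (l \<omega>)"
        using dl_pos[of \<omega>] by (simp add: field_simps)
      have dec: "C t (S t \<omega>) (w \<omega>) - c \<omega> \<le>
          \<bar>C t (S t \<omega>) (noncash k (v \<omega>))\<bar> + \<bar>C t (S t \<omega>) (noncash k (- v \<omega>))\<bar>"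
        using cost_decrement_le[OF additive S0, of "w \<omega>" "noncash k (v \<omega>)"]
        by (simp add: c_def noncash_diff noncash_minus w_eq)
      have "(INF z\<in>noncash_sphere k. D_pointwise C k t \<theta> \<omega> (S t \<omega>) 0 z) \<le>
          D_pointwise C k t \<theta> \<omega> (S t \<omega>) 0 z"
        by (rule INF_lower[OF z])
      also have "\<dots> = ereal (C t (S t \<omega>) z) + \<theta> \<omega> z" by (simp add: D_pointwise_def z_eq)
      also have "\<dots> \<le> ereal (C t (S t \<omega>) (w \<omega>) / d (l \<omega>)) + Z \<omega>"
        using Cz elim(1,2) by (intro add_mono) (auto simp: z_def)
      also have "\<dots> = ereal ((q + (C t (S t \<omega>) (w \<omega>) - c \<omega>)) / d (l \<omega>))"
        by (simp add: Z_def q diff_divide_distrib add_divide_distrib)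
      also have "\<dots> \<le> ereal ((q + \<bar>C t (S t \<omega>) (noncash k (v \<omega>))\<bar> +
          \<bar>C t (S t \<omega>) (noncash k (- v \<omega>))\<bar>) / d (norm (w \<omega>)))"
        using dec dl_pos[of \<omega>] unfolding l_eq[symmetric] by (auto intro!: divide_right_mono)
      finally show "(INF z\<in>noncash_sphere k. D_pointwise C k t \<theta> \<omega> (S t \<omega>) 0 z) \<le>
        ereal ((q + \<bar>C t (S t \<omega>) (noncash k (v \<omega>))\<bar> + \<bar>C t (S t \<omega>) (noncash k (- v \<omega>))\<bar>)
          / d (norm (w \<omega>)))" .
    qed
  qed
qed

end

section \<open>Closedness of sublevel families\<close>

context cost_market
begin

lemma Bseq_cost:
  assumes "t \<le> T" "x \<longlonglongrightarrow> x0"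
  shows "Bseq (\<lambda>j. C t s (x j))"
proof -
  obtain h where h: "continuous_on UNIV (\<lambda>(s, x). h s x)" "\<And>s x. \<bar>C t s x\<bar> \<le> h s x"
    using C_bound[OF assms(1)] by blast
  have "(\<lambda>j. (\<lambda>(s, x). h s x) (s, x j)) \<longlonglongrightarrow> (\<lambda>(s, x). h s x) (s, x0)"
    by (rule continuous_on_tendsto_compose[OF h(1)]) (auto intro!: tendsto_intros assms(2))
  then have "Bseq (\<lambda>j. h s (x j))"
    by (intro convergent_imp_Bseq convergentI) simp
  then obtain K where K: "\<And>j. \<bar>h s (x j)\<bar> \<le> K" by (auto simp: Bseq_def)
  show ?thesis
  proof (rule BseqI')
    fix j show "norm (C t s (x j)) \<le> K"
      using h(2)[of s "x j"] K[of j] by simp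
  qed
qed

text \<open>
  Nearly optimal strategies for \<open>v j\<close> have positions at time \<open>t\<close> that stay bounded along \<open>j\<close> outside a null
  set, so a measurable cluster point of these positions is a candidate first position for the limit
  \<open>v0\<close>, and lower semicontinuity shows that it is good enough.
\<close>

lemma hedging_cost_sublevel_closed:
  assumes t: "t < T"
    and d: "mono d" "\<And>r. 1 \<le> r \<Longrightarrow> 0 < d r" "filterlim d at_top at_top"
      "\<And>t r s x. t \<le> T \<Longrightarrow> 1 \<le> r \<Longrightarrow> 0 \<le> s \<Longrightarrow> d r * C t s x \<le> C t s (r *\<^sub>R x)"
    and \<xi>: "AE \<omega> in M. 0 \<le> \<xi> \<omega>"
    and additive: "(\<forall>s\<ge>0. \<forall>x y. C t s (x + y) \<ge> C t s x + C t s y) \<or>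
                   (\<forall>s\<ge>0. \<forall>x y. C t s (x + y) \<le> C t s x + C t s y)"
    and \<theta>: "theta_version M F T S C k (\<lambda>_. 0) t \<theta>"
    and D_pos: "AE \<omega> in M. 0 < (INF z\<in>noncash_sphere k. D_pointwise C k t \<theta> \<omega> (S t \<omega>) 0 z)"
    and \<gamma>_lsc: "\<And>\<omega>. \<omega> \<in> space M \<Longrightarrow> lsc (\<gamma> \<omega>)"
    and \<gamma>: "\<And>w. w \<in> borel_measurable (F t) \<Longrightarrow>
      AE \<omega> in M. hcost \<xi> (Suc t) w \<omega> = \<gamma> \<omega> (S (Suc t) \<omega>, w \<omega>)"
    and v: "\<And>j. v j \<in> borel_measurable (F t)" and v0: "v0 \<in> borel_measurable (F t)"
    and Y: "Y \<in> borel_measurable (F t)"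
    and v_lim: "\<And>\<omega>. (\<lambda>j. v j \<omega>) \<longlonglongrightarrow> v0 \<omega>"
    and le: "\<And>j. AE \<omega> in M. hcost \<xi> t (v j) \<omega> \<le> Y \<omega>"
  shows "AE \<omega> in M. hcost \<xi> t v0 \<omega> \<le> Y \<omega>"
proof -
  have tT: "t \<le> T" using t by simp
  \<comment> \<open>one margin admits strategies from \<open>v j\<close>, the other a continuation from the limiting position\<close>
  have "AE \<omega> in M. hcost \<xi> t v0 \<omega> \<le> loosen m (loosen l (Y \<omega>))" for l m
  proof -
    define Q where "Q \<omega> = loosen l (Y \<omega>)" for \<omega>
    note [measurable] = Y
    have Q[measurable]: "Q \<in> borel_measurable (F t)" unfolding Q_def by measurable
    have Q_nonMInf: "Q \<omega> \<noteq> - \<infinity>" for \<omega> by (simp add: Q_def loosen_noninf)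
    have "\<exists>V\<in>strats \<xi> t (v j). AE \<omega> in M. ereal (total_cost \<xi> t V \<omega>) \<le> Q \<omega>" for j
    proof -
      have "AE \<omega> in M. Q \<omega> < \<infinity> \<longrightarrow> hcost \<xi> t (v j) \<omega> < Q \<omega>"
        using le[of j]
      proof eventually_elim
        case (elim \<omega>)
        then show ?case
          using loosen_gt[of "Y \<omega>" l] loosen_eq_infinity_iff[of l "Y \<omega>"]
          by (cases "Y \<omega>") (auto simp: Q_def intro: le_less_trans)
      qed
      then show ?thesis by (rule ex_strategy_of_hedging_cost_less[OF tT Q]) blast
    qed
    then obtain V where V: "\<And>j. V j \<in> strats \<xi> t (v j)"
      and V_le: "\<And>j. AE \<omega> in M. ereal (total_cost \<xi> t (V j) \<omega>) \<le> Q \<omega>"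
      by metis
    define w where "w j = V j (int t)" for j
    have w: "w j \<in> borel_measurable (F t)" for j
      using V[of j] t by (simp add: w_def strategies_def L0_def)
    have step: "AE \<omega> in M. \<forall>j. \<gamma> \<omega> (S (Suc t) \<omega>, w j \<omega>) \<le>
        Q \<omega> - ereal (C t (S t \<omega>) (noncash k (w j \<omega> - v j \<omega>)))"
    proof (unfold AE_all_countable, intro allI)
      fix j
      show "AE \<omega> in M. \<gamma> \<omega> (S (Suc t) \<omega>, w j \<omega>) \<le>
          Q \<omega> - ereal (C t (S t \<omega>) (noncash k (w j \<omega> - v j \<omega>)))"
        using hedging_cost_Suc_le[OF t v V Q V_le, of j] \<gamma>[OF w[of j]]
        unfolding w_def[symmetric] by eventually_elim simp
    qed
    have bounded: "AE \<omega> in M. Q \<omega> < \<infinity> \<longrightarrow> Bseq (\<lambda>j. w j \<omega>)"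
    proof -
      have "AE \<omega> in M. \<forall>j. \<forall>q. Q \<omega> = ereal q \<longrightarrow> 1 \<le> norm (w j \<omega>) \<longrightarrow>
        (INF z\<in>noncash_sphere k. D_pointwise C k t \<theta> \<omega> (S t \<omega>) 0 z) \<le>
        ereal ((q + \<bar>C t (S t \<omega>) (noncash k (v j \<omega>))\<bar> + \<bar>C t (S t \<omega>) (noncash k (- v j \<omega>))\<bar>)
          / d (norm (w j \<omega>)))"
        unfolding AE_all_countable w_def
        by (intro allI strategy_position_bound[OF t d(1,2,4) \<xi> additive \<theta> v V Q V_le])
      with D_pos show ?thesis
      proof eventually_elim
        case (elim \<omega>)
        show ?case
        proof
          assume "Q \<omega> < \<infinity>"
          then obtain q where q: "Q \<omega> = ereal q" using Q_nonMInf[of \<omega>] by (cases "Q \<omega>") auto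
          \<comment> \<open>the infimum may be infinite; a real number below it suffices\<close>
          obtain e where e: "0 < e"
            "ereal e < (INF z\<in>noncash_sphere k. D_pointwise C k t \<theta> \<omega> (S t \<omega>) 0 z)"
            using ereal_dense2[OF elim(1)] by auto
          have lims: "(\<lambda>j. noncash k (v j \<omega>)) \<longlonglongrightarrow> noncash k (v0 \<omega>)"
            "(\<lambda>j. noncash k (- v j \<omega>)) \<longlonglongrightarrow> noncash k (- v0 \<omega>)"
            by (intro tendsto_noncash tendsto_minus v_lim)+
          have "Bseq (\<lambda>j. C t (S t \<omega>) (noncash k (v j \<omega>)))"
            "Bseq (\<lambda>j. C t (S t \<omega>) (noncash k (- v j \<omega>)))"
            by (rule Bseq_cost[OF tT lims(1)] Bseq_cost[OF tT lims(2)])+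
          then obtain K1 K2 where K: "\<And>j. \<bar>C t (S t \<omega>) (noncash k (v j \<omega>))\<bar> \<le> K1"
            "\<And>j. \<bar>C t (S t \<omega>) (noncash k (- v j \<omega>))\<bar> \<le> K2"
            by (auto simp: Bseq_def)
          obtain r0 where r0: "\<And>r. r0 \<le> r \<Longrightarrow> (q + K1 + K2) / e \<le> d r"
            using d(3) unfolding filterlim_at_top eventually_at_top_linorder by blast
          show "Bseq (\<lambda>j. w j \<omega>)"
          proof (rule BseqI', rule ccontr)
            fix j assume "\<not> norm (w j \<omega>) \<le> max 1 r0"
            then have w1: "1 \<le> norm (w j \<omega>)" and wr: "r0 \<le> norm (w j \<omega>)" by auto
            note dw = d(2)[OF w1]
            have "ereal e < ereal ((q + \<bar>C t (S t \<omega>) (noncash k (v j \<omega>))\<bar> +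
                \<bar>C t (S t \<omega>) (noncash k (- v j \<omega>))\<bar>) / d (norm (w j \<omega>)))"
              using elim(2) q w1 by (intro less_le_trans[OF e(2)]) blast
            then have "e * d (norm (w j \<omega>)) < q + \<bar>C t (S t \<omega>) (noncash k (v j \<omega>))\<bar> +
                \<bar>C t (S t \<omega>) (noncash k (- v j \<omega>))\<bar>"
              using dw by (simp add: pos_less_divide_eq)
            also have "\<dots> \<le> q + K1 + K2" by (intro add_mono order_refl K)
            also have "\<dots> \<le> e * d (norm (w j \<omega>))"
              using r0[OF wr] e(1) by (simp add: pos_divide_le_eq mult.commute)
            finally show False by simp
          qed
        qed
      qed
    qed
    obtain W where W: "W \<in> borel_measurable (F t)"
      and cluster: "\<And>\<omega>. Bseq (\<lambda>j. w j \<omega>) \<Longrightarrow> \<exists>r. strict_mono r \<and> (\<lambda>j. w (r j) \<omega>) \<longlonglongrightarrow> W \<omega>"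
      by (rule measurable_cluster_point[of w, OF w]) blast
    from step bounded have "AE \<omega> in M. Q \<omega> < \<infinity> \<longrightarrow>
        hcost \<xi> (Suc t) W \<omega> < loosen m (Q \<omega>) - ereal (C t (S t \<omega>) (noncash k (W \<omega> - v0 \<omega>)))"
      using \<gamma>[OF W] AE_space
    proof eventually_elim
      case (elim \<omega>)
      show ?case
      proof
        assume fin: "Q \<omega> < \<infinity>"
        then obtain q where q: "Q \<omega> = ereal q" using Q_nonMInf[of \<omega>] by (cases "Q \<omega>") auto
        obtain r where r: "strict_mono r" "(\<lambda>j. w (r j) \<omega>) \<longlonglongrightarrow> W \<omega>"
          using cluster elim(2) fin by blast
        have vr: "(\<lambda>j. v (r j) \<omega>) \<longlonglongrightarrow> v0 \<omega>"
          using LIMSEQ_subseq_LIMSEQ[OF v_lim r(1)] by (simp add: o_def)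
        let ?f = "\<lambda>(s, x). C t s x"
        have "?f (S t \<omega>, noncash k (w (r j) \<omega> - v (r j) \<omega>)) =
            C t (S t \<omega>) (noncash k (w (r j) \<omega> - v (r j) \<omega>))" for j by simp
        then have le_q: "\<gamma> \<omega> (S (Suc t) \<omega>, w (r j) \<omega>) \<le>
            ereal q - ereal (?f (S t \<omega>, noncash k (w (r j) \<omega> - v (r j) \<omega>)))" for j
          using elim(1) unfolding q by metis
        have lim_f: "(\<lambda>j. (S t \<omega>, noncash k (w (r j) \<omega> - v (r j) \<omega>)))
            \<longlonglongrightarrow> (S t \<omega>, noncash k (W \<omega> - v0 \<omega>))"
          by (intro tendsto_Pair tendsto_const tendsto_noncash tendsto_diff r(2) vr)
        have lim_g: "(\<lambda>j. (S (Suc t) \<omega>, w (r j) \<omega>)) \<longlonglongrightarrow> (S (Suc t) \<omega>, W \<omega>)"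
          by (intro tendsto_Pair tendsto_const r(2))
        have "\<gamma> \<omega> (S (Suc t) \<omega>, W \<omega>) \<le>
            ereal q - ereal (?f (S t \<omega>, noncash k (W \<omega> - v0 \<omega>)))"
          by (rule lsc_sum_le_of_limit[OF C_lsc[OF tT] lim_f \<gamma>_lsc[OF elim(4)] lim_g le_q])
        then have "hcost \<xi> (Suc t) W \<omega> \<le> ereal (q - C t (S t \<omega>) (noncash k (W \<omega> - v0 \<omega>)))"
          using elim(3) by simp
        also have "\<dots> < loosen m (Q \<omega>) - ereal (C t (S t \<omega>) (noncash k (W \<omega> - v0 \<omega>)))"
          using loosen_gt[OF fin, of m] by (cases "loosen m (Q \<omega>)") (auto simp: q)
        finally show "hcost \<xi> (Suc t) W \<omega> <
          loosen m (Q \<omega>) - ereal (C t (S t \<omega>) (noncash k (W \<omega> - v0 \<omega>)))" .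
      qed
    qed
    then have "AE \<omega> in M. loosen m (Q \<omega>) < \<infinity> \<longrightarrow>
        hcost \<xi> (Suc t) W \<omega> < loosen m (Q \<omega>) - ereal (C t (S t \<omega>) (noncash k (W \<omega> - v0 \<omega>)))"
      by eventually_elim (auto simp: less_top[symmetric] loosen_eq_infinity_iff)
    moreover have "(\<lambda>\<omega>. loosen m (Q \<omega>)) \<in> borel_measurable (F t)" by measurable
    ultimately show ?thesis
      unfolding Q_def[symmetric] by (intro hedging_cost_le_of_Suc[OF t v0 W]) auto
  qed
  then have "AE \<omega> in M. \<forall>l m. hcost \<xi> t v0 \<omega> \<le> loosen m (loosen l (Y \<omega>))"
    by (simp add: AE_all_countable)
  then show ?thesis
    by eventually_elim (rule le_of_le_loosen, rule le_of_le_loosen, blast)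
qed

end

section \<open>The hedging cost as a normal integrand\<close>

theorem theorem4p13:
  fixes M :: "'a measure"
    and F :: "nat \<Rightarrow> 'a measure"
    and T t :: nat
    and S :: "nat \<Rightarrow> 'a \<Rightarrow> real ^ 'm"
    and C :: "nat \<Rightarrow> real ^ 'm \<Rightarrow> real ^ 'd \<Rightarrow> real"
    and k :: 'd
    and \<delta> :: "ennreal \<Rightarrow> ennreal"
    and \<xi> :: "'a \<Rightarrow> real ^ 'd"
    and g :: "real ^ 'm \<Rightarrow> real ^ 'd"
    and \<phi> :: "nat \<Rightarrow> real ^ 'm \<Rightarrow> (real ^ 'm) set"
    and R :: "nat \<Rightarrow> real ^ 'm \<Rightarrow> real"
    and \<gamma>_next :: "'a \<Rightarrow> (real ^ 'm) \<times> (real ^ 'd) \<Rightarrow> ereal"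
    and \<theta>0 :: "'a \<Rightarrow> real ^ 'd \<Rightarrow> ereal"
  assumes market: "cost_market M F T S C k"
    and t: "t < T"
    and homogeneous: "super_homogeneous T C \<delta>"
    and xi_meas: "\<xi> \<in> L0 M (F T) UNIV"
    and gamma_next_normal: "normal_integrand (F (Suc t)) \<gamma>_next"
    and gamma_next: "\<forall>V\<in>L0 M (F t) UNIV. AE \<omega> in M.
      hedging_cost M F T S C k \<xi> (Suc t) V \<omega> = \<gamma>_next \<omega> (S (Suc t) \<omega>, V \<omega>)"
    and g_cont: "continuous_on UNIV g"
    and g_nonneg: "\<forall>s. 0 \<le> g s"
    and xi_eq: "AE \<omega> in M. \<xi> \<omega> = g (S T \<omega>)"
    and xi_hedgeable: "hedgeable M F T S C k \<xi>"
    and support: "\<forall>u<T. is_cond_support M (F u) (S (Suc u)) (\<lambda>\<omega>. \<phi> u (S u \<omega>))"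
    and phi_lhc: "\<forall>u<T. lower_hemicontinuous (\<phi> u)"
    and phi_compact: "\<forall>u<T. \<forall>s. compact (\<phi> u s)"
    and R_cont: "\<forall>u<T. continuous_on UNIV (R u)"
    and phi_bounded: "\<forall>u<T. AE \<omega> in M. \<phi> u (S u \<omega>) \<subseteq> cball 0 (R u (S u \<omega>))"
    and C_normal: "normal_integrand (F t) (\<lambda>\<omega> (s, z). ereal (C t s z))"
    and C_additive: "(\<forall>s\<ge>0. \<forall>x y. C t s (x + y) \<ge> C t s x + C t s y) \<or>
                     (\<forall>s\<ge>0. \<forall>x y. C t s (x + y) \<le> C t s x + C t s y)"
    and theta0: "theta_version M F T S C k (\<lambda>_. 0) t \<theta>0"
    and D_pos: "AE \<omega> in M. (INF z\<in>noncash_sphere k. D_pointwise C k t \<theta>0 \<omega> (S t \<omega>) 0 z) > 0"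
  shows "\<exists>\<gamma>_t :: 'a \<Rightarrow> (real ^ 'm) \<times> (real ^ 'd) \<Rightarrow> ereal.
    normal_integrand (F t) \<gamma>_t \<and>
    (\<forall>V\<in>L0 M (F t) UNIV. AE \<omega> in M.
      hedging_cost M F T S C k \<xi> t V \<omega> = \<gamma>_t \<omega> (S t \<omega>, V \<omega>))"
proof -
  interpret cost_market M F T S C k by (rule market)
  have tT: "t \<le> T" "Suc t \<le> T" using t by auto
  obtain d where d: "mono d" "\<And>r. 1 \<le> r \<Longrightarrow> 0 < d r" "filterlim d at_top at_top"
    "\<And>t r s x. t \<le> T \<Longrightarrow> 1 \<le> r \<Longrightarrow> 0 \<le> s \<Longrightarrow> d r * C t s x \<le> C t s (r *\<^sub>R x)"
    using super_homogeneous_real_rate[OF homogeneous] by blast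
  have \<xi>: "AE \<omega> in M. 0 \<le> \<xi> \<omega>"
    using xi_eq by eventually_elim (use g_nonneg in auto)
  have \<gamma>_lsc: "lsc (\<gamma>_next \<omega>)" if "\<omega> \<in> space M" for \<omega>
    using gamma_next_normal that by (auto simp: normal_integrand_def space_F[OF tT(2)])
  have \<gamma>: "AE \<omega> in M. hcost \<xi> (Suc t) w \<omega> = \<gamma>_next \<omega> (S (Suc t) \<omega>, w \<omega>)"
    if "w \<in> borel_measurable (F t)" for w
    using gamma_next that by (simp add: L0_def)
  obtain \<theta> where \<theta>: "normal_integrand (F t) \<theta>"
    "\<And>V. V \<in> borel_measurable (F t) \<Longrightarrow> AE \<omega> in M. hcost \<xi> t V \<omega> = \<theta> \<omega> (V \<omega>)"
  proof (rule normal_integrand_representation[OF subalg[OF tT(1)], of "hcost \<xi> t"])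
    show "hcost \<xi> t V \<in> borel_measurable (F t)" for V
      by (rule borel_measurable_hedging_cost[OF tT(1)])
    show "AE \<omega> in M. \<omega> \<in> A \<longrightarrow> hcost \<xi> t V \<omega> = hcost \<xi> t W \<omega>"
      if "A \<in> sets (F t)" "\<And>\<omega>. \<omega> \<in> A \<Longrightarrow> V \<omega> = W \<omega>" for V W A
      by (rule hedging_cost_local[OF tT(1) that])
    show "AE \<omega> in M. hcost \<xi> t W \<omega> \<le> Y \<omega>"
      if "\<And>j. V j \<in> borel_measurable (F t)" "W \<in> borel_measurable (F t)"
        "Y \<in> borel_measurable (F t)" "\<And>\<omega>. (\<lambda>j. V j \<omega>) \<longlonglongrightarrow> W \<omega>"
        "\<And>j. AE \<omega> in M. hcost \<xi> t (V j) \<omega> \<le> Y \<omega>" for V :: "nat \<Rightarrow> 'a \<Rightarrow> real ^ 'd" and W Y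
      by (rule hedging_cost_sublevel_closed[OF t d \<xi> _ theta0 D_pos \<gamma>_lsc \<gamma> that])
        (use C_additive in auto)
  qed blast
  show ?thesis
  proof (intro exI conjI ballI)
    \<comment> \<open>the price argument is pinned to the current price\<close>
    show "normal_integrand (F t)
        (\<lambda>\<omega> p. if fst p = S t \<omega> then \<theta> \<omega> (snd p) else \<infinity>)"
      by (rule normal_integrand_on_graph[OF \<theta>(1) S_measurable[OF tT(1)]])
    fix V assume "V \<in> L0 M (F t) (UNIV :: (real ^ 'd) set)"
    then show "AE \<omega> in M. hcost \<xi> t V \<omega> =
        (if fst (S t \<omega>, V \<omega>) = S t \<omega> then \<theta> \<omega> (snd (S t \<omega>, V \<omega>)) else \<infinity>)"
      using \<theta>(2)[of V] by (simp add: L0_def)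
  qed
qed

end
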